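(* Let $t$ be a positive integer, $\mu$ a $t$-core partition and $1\le k\le t-1$. Then for every nonnegative integer $n$, $$\sum_{\substack{\lambda_{t\text{-core}}=\mu\\ |\lambda|-|\mu|=nt}}F_{\lambda/\mu}G_\lambda\Biggl(\sum_{\substack{\square\in\lambda\\ h_\square\equiv k\ (\mathrm{mod}\ t)}}h_\square^2+\sum_{\substack{\square\in\lambda\\ h_\square\equiv t-k\ (\mathrm{mod}\ t)}}h_\square^2\Biggr)=6t\binom n2+\bigl(2k(t-k)+4t|\mu(k)|+4t|\mu(t-k)|\bigr)n+\sum_{\substack{\square\in\mu\\ h_\square\equiv k\ (\mathrm{mod}\ t)}}h_\square^2+\sum_{\substack{\square\in\mu\\ h_\square\equiv t-k\ (\mathrm{mod}\ t)}}h_\square^2,$$ where $\mu(k)=\{h\in\mathcal H(\mu): h\equiv k\pmod t\}$ as a multiset. In particular, for $\mu=\emptyset$, $$\sum_{\substack{\lambda_{t\text{-core}}=\emptyset\\ |\lambda|=nt}}F_{\lambda}G_\lambda\Biggl(\sum_{\substack{\square\in\lambda\\ h_\square\equiv k\ (\mathrm{mod}\ t)}}h_\square^2+\sum_{\substack{\square\in\lambda\\ h_\square\equiv t-k\ (\mathrm{mod}\ t)}}h_\square^2\Biggr)=6t\binom n2+2k(t-k)n.$$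
   Context: Partitions are identified with Young diagrams; $h_\square$ is the hook length of a box (boxes to its right in its row, plus below it in its column, plus one), $\mathcal H(\lambda)$ the multiset of hook lengths. A $t$-core is a partition with no hook length divisible by $t$. The 01-sequence $(z_i)_{i\in\mathbb Z}$ of $\lambda$: traverse the boundary of the Young diagram from the bottom (infinite vertical ray below the first column) to the right (infinite horizontal ray right of the first row), labelling vertical edges $0$ and horizontal edges $1$, indexed so that $\#\{i\ge0:z_i=0\}=\#\{i<0:z_i=1\}$. Adding a $t$-hook means exchanging some $z_i=0,z_{i+t}=1$ into $1,0$; removing one is the reverse. $\lambda\ge_t\mu$ means $\lambda$ is obtained from $\mu$ by adding $t$-hooks. The $t$-core $\lambda_{t\text{-core}}$ is obtained by removing $t$-hooks until impossible (independent of choices). $F_{\lambda/\mu}$ (for $\lambda\ge_t\mu$): $F_{\mu/\mu}=1$ and $F_{\lambda/\mu}=\sum F_{\lambda^-/\mu}$ over all $\lambda^-$ with $\lambda\ge_t\lambda^-\ge_t\mu$, $|\lambda|-|\lambda^-|=t$; $F_\lambda=F_{\lambda/\lambda_{t\text{-core}}}$. $G_\lambda=1/\prod_{h\in\mathcal H(\lambda),\,t\mid h}h$. *)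

theory Defs
  imports Complex_Main "HOL-Library.Multiset" "HOL-Number_Theory.Cong"
begin

text \<open>
  A partition is its Young diagram in English notation: \<open>(i, j)\<close> is the box in row \<open>i\<close> (counted
  downwards) and column \<open>j\<close>, both counted from \<open>0\<close>. Thus \<open>|\<rho>|\<close> is \<open>card \<rho>\<close> and the empty
  partition is \<open>{}\<close>.
\<close>

definition young_diagram :: "(nat \<times> nat) set \<Rightarrow> bool" where
  "young_diagram \<rho> \<longleftrightarrow> finite \<rho> \<and> (\<forall>i j i' j'. (i, j) \<in> \<rho> \<longrightarrow> i' \<le> i \<longrightarrow> j' \<le> j \<longrightarrow> (i', j') \<in> \<rho>)"

definition row_length :: "(nat \<times> nat) set \<Rightarrow> nat \<Rightarrow> nat" where
  "row_length \<rho> i = card {j. (i, j) \<in> \<rho>}"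

definition col_length :: "(nat \<times> nat) set \<Rightarrow> nat \<Rightarrow> nat" where
  "col_length \<rho> j = card {i. (i, j) \<in> \<rho>}"

fun hook_length :: "(nat \<times> nat) set \<Rightarrow> nat \<times> nat \<Rightarrow> nat" where
  "hook_length \<rho> (i, j) = card {j'. j < j' \<and> (i, j') \<in> \<rho>} + card {i'. i < i' \<and> (i', j) \<in> \<rho>} + 1"

definition hook_lengths :: "(nat \<times> nat) set \<Rightarrow> nat multiset" where
  "hook_lengths \<rho> = image_mset (hook_length \<rho>) (mset_set \<rho>)"

definition hook_lengths_mod :: "nat \<Rightarrow> (nat \<times> nat) set \<Rightarrow> nat \<Rightarrow> nat multiset" where
  "hook_lengths_mod t \<rho> k = {#h \<in># hook_lengths \<rho>. [h = k] (mod t)#}"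

definition is_t_core :: "nat \<Rightarrow> (nat \<times> nat) set \<Rightarrow> bool" where
  "is_t_core t \<rho> \<longleftrightarrow> young_diagram \<rho> \<and> (\<forall>h \<in># hook_lengths \<rho>. \<not> t dvd h)"

text \<open>
  The 01-sequence. Let \<open>x\<close> grow to the right and \<open>y\<close> downwards. Each step of the boundary path,
  traversed from the bottom to the right, increases \<open>x - y\<close> by \<open>1\<close>, and an edge is given the
  value of \<open>x - y\<close> at its starting point as index. The vertical edge at the end of row \<open>i\<close> runs
  from \<open>(\<rho>\<^sub>i, i + 1)\<close> to \<open>(\<rho>\<^sub>i, i)\<close>, so its index is \<open>\<rho>\<^sub>i - i - 1\<close>; the horizontal edge at the end
  of column \<open>j\<close>, of length \<open>c\<close>, has index \<open>j - c\<close>. The lemmas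
  \<open>zero_one_seq_eq_1_iff\<close> and \<open>zero_one_seq_balanced\<close> below show that the labels 1 are exactly
  those of the horizontal edges and that
  \<open>#{m \<ge> 0. z\<^sub>m = 0} = #{m < 0. z\<^sub>m = 1}\<close>.
\<close>

definition zero_one_seq :: "(nat \<times> nat) set \<Rightarrow> int \<Rightarrow> nat" where
  "zero_one_seq \<rho> m = (if \<exists>i. m = int (row_length \<rho> i) - int i - 1 then 0 else 1)"

lemma young_diagram_row:
  assumes "young_diagram \<rho>"
  shows "(i, j) \<in> \<rho> \<longleftrightarrow> j < row_length \<rho> i"
proof -
  have fin: "finite {j. (i, j) \<in> \<rho>}"
    using assms finite_imageI[of \<rho> snd] unfolding young_diagram_def
    by (elim conjE) (rule finite_subset[of _ "snd ` \<rho>"], force+)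
  have down: "j' \<in> {j. (i, j) \<in> \<rho>}" if "j \<in> {j. (i, j) \<in> \<rho>}" "j' \<le> j" for j j'
    using assms that unfolding young_diagram_def by blast
  show ?thesis
  proof
    assume "(i, j) \<in> \<rho>"
    then have "{..j} \<subseteq> {j. (i, j) \<in> \<rho>}" using down by auto
    from card_mono[OF fin this] show "j < row_length \<rho> i" by (simp add: row_length_def)
  next
    assume a: "j < row_length \<rho> i"
    show "(i, j) \<in> \<rho>"
    proof (rule ccontr)
      assume "(i, j) \<notin> \<rho>"
      then have "{j. (i, j) \<in> \<rho>} \<subseteq> {..<j}" using down by (metis mem_Collect_eq lessThan_iff not_le subsetI)
      from card_mono[OF _ this] a show False by (simp add: row_length_def)
    qed
  qed
qed

lemma young_diagram_col:
  assumes "young_diagram \<rho>"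
  shows "(i, j) \<in> \<rho> \<longleftrightarrow> i < col_length \<rho> j"
proof -
  have "young_diagram (\<rho>\<inverse>)"
    using assms unfolding young_diagram_def by auto
  from young_diagram_row[OF this, of j i] show ?thesis
    by (simp add: row_length_def col_length_def)
qed

lemma zero_one_seq_eq_1_iff:
  assumes "young_diagram \<rho>"
  shows "zero_one_seq \<rho> m = 1 \<longleftrightarrow> (\<exists>j. m = int j - int (col_length \<rho> j))"
proof -
  have rc: "j < row_length \<rho> i \<longleftrightarrow> i < col_length \<rho> j" for i j
    using young_diagram_row[OF assms] young_diagram_col[OF assms] by blast
  have "\<exists>j. m = int j - int (col_length \<rho> j)"
    if no: "\<nexists>i. m = int (row_length \<rho> i) - int i - 1"
  proof -
    let ?P = "\<lambda>i. int (row_length \<rho> i) - int i - 1 \<le> m"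
    have mono: "row_length \<rho> i \<le> row_length \<rho> 0" for i
      using rc by (metis not_le le0 le_less_trans less_irrefl)
    have "?P (nat (int (row_length \<rho> 0) + \<bar>m\<bar>))"
      using mono[of "nat (int (row_length \<rho> 0) + \<bar>m\<bar>)"] by linarith
    then have P: "?P (LEAST i. ?P i)" by (rule LeastI)
    define i where "i = (LEAST i. ?P i)"
    have i: "int (row_length \<rho> i) - int i - 1 < m" using P no i_def by (metis order.not_eq_order_implies_strict)
    define j where "j = nat (m + int i)"
    have j: "int j = m + int i" using i by (simp add: j_def)
    have "col_length \<rho> j \<le> i" using rc[of j i] i j by linarith
    moreover have "i \<le> col_length \<rho> j"
    proof (cases i)
      case (Suc l)
      then have "\<not> ?P l" using not_less_Least[of l ?P] i_def by simp
      then have "j < row_length \<rho> l" using j Suc by linarith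
      then show ?thesis using rc[of j l] Suc by linarith
    qed simp
    ultimately show ?thesis using j by (intro exI[of _ j]) linarith
  qed
  moreover have "int (row_length \<rho> i) - int i - 1 \<noteq> int j - int (col_length \<rho> j)" for i j
    using rc[of j i] by linarith
  ultimately show ?thesis unfolding zero_one_seq_def by (metis zero_neq_one)
qed

lemma zero_one_seq_balanced:
  assumes "young_diagram \<rho>"
  shows "finite {m. m \<ge> 0 \<and> zero_one_seq \<rho> m = 0}"
    and "finite {m. m < 0 \<and> zero_one_seq \<rho> m = 1}"
    and "card {m. m \<ge> 0 \<and> zero_one_seq \<rho> m = 0} = card {m. m < 0 \<and> zero_one_seq \<rho> m = 1}"
proof -
  let ?D = "{i. (i, i) \<in> \<rho>}"
  let ?f = "\<lambda>i. int (row_length \<rho> i) - int i - 1"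
  let ?g = "\<lambda>j. int j - int (col_length \<rho> j)"
  note row = young_diagram_row[OF assms] and col = young_diagram_col[OF assms]
  have fin: "finite ?D"
    using assms finite_imageI[of \<rho> fst] unfolding young_diagram_def
    by (elim conjE) (rule finite_subset[of _ "fst ` \<rho>"], force+)
  have rmono: "row_length \<rho> i' \<le> row_length \<rho> i" if "i \<le> i'" for i i'
    using that row col by (metis le_less_trans less_irrefl not_le)
  have cmono: "col_length \<rho> i' \<le> col_length \<rho> i" if "i \<le> i'" for i i'
    using that row col by (metis le_less_trans less_irrefl not_le)
  have 1: "{m. m \<ge> 0 \<and> zero_one_seq \<rho> m = 0} = ?f ` ?D"
    by (auto simp: zero_one_seq_def row split: if_splits)
  have 2: "{m. m < 0 \<and> zero_one_seq \<rho> m = 1} = ?g ` ?D"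
    unfolding zero_one_seq_eq_1_iff[OF assms] by (auto simp: col)
  have f: "inj ?f"
  proof (rule linorder_injI)
    fix x y :: nat assume "x < y" then show "?f x \<noteq> ?f y" using rmono[of x y] by linarith
  qed
  have g: "inj ?g"
  proof (rule linorder_injI)
    fix x y :: nat assume "x < y" then show "?g x \<noteq> ?g y" using cmono[of x y] by linarith
  qed
  show "finite {m. m \<ge> 0 \<and> zero_one_seq \<rho> m = 0}" "finite {m. m < 0 \<and> zero_one_seq \<rho> m = 1}"
    unfolding 1 2 using fin by simp_all
  show "card {m. m \<ge> 0 \<and> zero_one_seq \<rho> m = 0} = card {m. m < 0 \<and> zero_one_seq \<rho> m = 1}"
    unfolding 1 2 using card_image[OF inj_on_subset[OF f]] card_image[OF inj_on_subset[OF g]] by simp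
qed

definition adds_t_hook :: "nat \<Rightarrow> (nat \<times> nat) set \<Rightarrow> (nat \<times> nat) set \<Rightarrow> bool" where
  "adds_t_hook t \<mu> \<rho> \<longleftrightarrow> young_diagram \<mu> \<and> young_diagram \<rho> \<and>
     (\<exists>i. zero_one_seq \<mu> i = 0 \<and> zero_one_seq \<mu> (i + int t) = 1 \<and>
          zero_one_seq \<rho> = (zero_one_seq \<mu>)(i := 1, i + int t := 0))"

definition t_geq :: "nat \<Rightarrow> (nat \<times> nat) set \<Rightarrow> (nat \<times> nat) set \<Rightarrow> bool" where
  "t_geq t \<rho> \<mu> \<longleftrightarrow> (adds_t_hook t)\<^sup>*\<^sup>* \<mu> \<rho>"

definition t_core :: "nat \<Rightarrow> (nat \<times> nat) set \<Rightarrow> (nat \<times> nat) set" where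
  "t_core t \<rho> = (THE \<mu>. t_geq t \<rho> \<mu> \<and> (\<nexists>\<nu>. adds_t_hook t \<nu> \<mu>))"

lemma t_geq_0: "t_geq 0 \<rho> \<mu> \<Longrightarrow> \<rho> = \<mu>"
  unfolding t_geq_def by (erule converse_rtranclpE) (auto simp: adds_t_hook_def)

function F_skew :: "nat \<Rightarrow> (nat \<times> nat) set \<Rightarrow> (nat \<times> nat) set \<Rightarrow> nat" where
  "F_skew t \<rho> \<mu> =
     (if \<rho> = \<mu> then 1
      else \<Sum>\<nu> \<in> {\<nu>. t_geq t \<rho> \<nu> \<and> t_geq t \<nu> \<mu> \<and> card \<rho> = card \<nu> + t}. F_skew t \<nu> \<mu>)"
  by pat_completeness auto
termination
proof (relation "Wellfounded.measure (\<lambda>(t, \<rho>, \<mu>). card \<rho>)", goal_cases)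
  case (2 t \<rho> \<mu> \<nu>)
  then have "t \<noteq> 0" using t_geq_0[of \<rho> \<nu>] t_geq_0[of \<nu> \<mu>] by (cases "t = 0") auto
  then show ?case using 2 by simp
qed simp

text \<open>The defining equation is unconditional and would loop as a rewrite rule.\<close>
declare F_skew.simps [simp del]

definition F_fun :: "nat \<Rightarrow> (nat \<times> nat) set \<Rightarrow> nat" where
  "F_fun t \<rho> = F_skew t \<rho> (t_core t \<rho>)"

definition G_fun :: "nat \<Rightarrow> (nat \<times> nat) set \<Rightarrow> real" where
  "G_fun t \<rho> = 1 / real (\<Prod>h \<in># {#h \<in># hook_lengths \<rho>. t dvd h#}. h)"

end

theory Submission
  imports Defs "HOL-Library.Confluence"
begin

text \<open>
  Encode a partition by its beads, the positions of the labels 0 in the 01-sequence (shifted so that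
  everything to the left of position 0 is a bead). Boxes are pairs of a gap and a bead to its right,
  the hook length is their distance, and adding a \<open>t\<close>-hook moves a bead from \<open>b\<close> to \<open>b + t\<close>.

  The ratio \<open>G\<^sub>\<rho> / G\<^sub>\<nu>\<close> for such a move is, up to a factor \<open>t (b + t - r)\<close> with \<open>r = b mod t\<close>, the residue
  at \<open>b\<close> of the rational function \<open>\<Prod>\<^sub>x (1 + t / (z - x))\<close>, where \<open>x\<close> ranges over the beads congruent to \<open>b\<close>.
  So the ratios add up to 1, i.e. they are transition probabilities, and their moments of order at
  most two are polynomials in the bead positions. The increment of the sum of the squared hook
  lengths congruent to \<open>\<plusminus>k\<close> is, on each residue class, a quadratic polynomial in \<open>b\<close>, because the
  contributions of gaps and beads on the neighbouring runners combine to power sums. Hence the mean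
  increment is \<open>6 \<Sum> beads + C\<close>, where \<open>C\<close> depends only on the number of beads in each residue class,
  that is, on the \<open>t\<close>-core; each added hook raises it by \<open>6 t\<close>.
  It remains to evaluate the mean increment at the core and to sum over \<open>n\<close> steps.
\<close>

section \<open>Partial fractions\<close>

text \<open>Multiplied by \<open>c\<close>, this is the residue at \<open>z = i\<close> of the
  rational function \<open>\<Prod>x\<in>X. 1 + c / (z - x)\<close>.\<close>

definition node_weight :: "real \<Rightarrow> nat set \<Rightarrow> nat \<Rightarrow> real" where
  "node_weight c X i = (\<Prod>x\<in>X - {i}. 1 + c / (real i - real x))"

lemma node_weight_insert:
  assumes "finite X" "y \<notin> X" "i \<in> X"
  shows "node_weight c (insert y X) i = node_weight c X i * (1 + c / (real i - real y))"
proof -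
  have "insert y X - {i} = insert y (X - {i})" using assms by auto
  then show ?thesis using assms by (simp add: node_weight_def)
qed

lemma node_weight_insert_self:
  assumes "y \<notin> X"
  shows "node_weight c (insert y X) y = (\<Prod>x\<in>X. 1 + c / (real y - real x))"
  using assms by (simp add: node_weight_def)

text \<open>The product has simple poles at the nodes and tends to 1 at infinity. The induction
  distributes the factor of a new node \<open>y\<close> over the expansion and splits each
  \<open>1 / ((z - y) * (z - i))\<close>; the parts with pole \<open>y\<close> collect into the
  weight of \<open>y\<close>.\<close>

lemma prod_partial_fractions:
  assumes "finite X" "z \<notin> real ` X"
  shows "(\<Prod>x\<in>X. 1 + c / (z - real x)) = 1 + (\<Sum>i\<in>X. c * node_weight c X i / (z - real i))"
  using assms
proof (induction X arbitrary: z rule: finite_induct)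
  case (insert y X)
  let ?w = "node_weight c X"
  have z: "z \<noteq> real y" "\<And>i. i \<in> X \<Longrightarrow> z \<noteq> real i" using insert.prems by auto
  have y: "real y \<notin> real ` X" using insert.hyps by auto
  \<comment> \<open>The weight of the new node is the old product at \<open>z = y\<close>, so the
    induction hypothesis expands it.\<close>
  have wy: "node_weight c (insert y X) y = 1 + (\<Sum>i\<in>X. c * ?w i / (real y - real i))"
    using insert.IH[OF y] node_weight_insert_self[OF insert.hyps(2)] by simp
  have "(\<Sum>i\<in>X. c * node_weight c (insert y X) i / (z - real i))
     = (\<Sum>i\<in>X. c * ?w i / (z - real i) + c / (z - real y) * (c * ?w i / (z - real i))
          - c / (z - real y) * (c * ?w i / (real y - real i)))"
  proof (rule sum.cong)
    fix i assume i: "i \<in> X"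
    define d e where "d = real i - real y" and "e = z - real i"
    have "d \<noteq> 0" "e \<noteq> 0" "e + d \<noteq> 0" and de: "z - real y = e + d" "real y - real i = - d"
      using z i insert.hyps by (auto simp: d_def e_def)
    then show "c * node_weight c (insert y X) i / (z - real i)
      = c * ?w i / (z - real i) + c / (z - real y) * (c * ?w i / (z - real i))
          - c / (z - real y) * (c * ?w i / (real y - real i))"
      unfolding node_weight_insert[OF insert.hyps i] de d_def[symmetric] e_def[symmetric]
      by (simp add: divide_simps) (simp add: algebra_simps)
  qed simp
  then have "(\<Sum>i\<in>X. c * node_weight c (insert y X) i / (z - real i))
     = (\<Sum>i\<in>X. c * ?w i / (z - real i))
       + c / (z - real y) * (\<Sum>i\<in>X. c * ?w i / (z - real i))
       - c / (z - real y) * (\<Sum>i\<in>X. c * ?w i / (real y - real i))"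
    unfolding sum_distrib_left by (simp only: sum.distrib sum_subtractf)
  then have "1 + (\<Sum>i\<in>insert y X. c * node_weight c (insert y X) i / (z - real i))
     = (1 + c / (z - real y)) * (1 + (\<Sum>i\<in>X. c * ?w i / (z - real i)))"
    using insert.hyps wy by (simp add: add_divide_distrib distrib_left distrib_right)
  also have "\<dots> = (\<Prod>x\<in>insert y X. 1 + c / (z - real x))"
    using insert.IH[of z] z insert.hyps insert.prems by simp
  finally show ?case by simp
qed simp

text \<open>Multiplied by \<open>c\<close>, these are the coefficients of \<open>1/z\<close> and
  \<open>1/z^2\<close> in the expansion at infinity of both sides of
  \<open>prod_partial_fractions\<close>; the induction avoids limits.\<close>

lemma sum_node_weight:
  assumes "finite X"
  shows "(\<Sum>i\<in>X. node_weight c X i) = real (card X)"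
    and "(\<Sum>i\<in>X. node_weight c X i * real i)
      = (\<Sum>x\<in>X. real x) + c * real (card X) * (real (card X) - 1) / 2"
  using assms
proof (induction X rule: finite_induct)
  case (insert y X)
  let ?w = "node_weight c X"
  have y: "real y \<notin> real ` X" using insert.hyps by auto
  have wy: "node_weight c (insert y X) y = 1 + (\<Sum>i\<in>X. c * ?w i / (real y - real i))"
    using prod_partial_fractions[OF insert.hyps(1) y] node_weight_insert_self[OF insert.hyps(2)] by simp
  have w0: "(\<Sum>i\<in>X. node_weight c (insert y X) i) = (\<Sum>i\<in>X. ?w i - c * ?w i / (real y - real i))"
  proof (rule sum.cong)
    fix i assume i: "i \<in> X"
    define d where "d = real i - real y"
    have "d \<noteq> 0" and de: "real y - real i = - d" "real i = real y + d"
      using i insert.hyps by (auto simp: d_def)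
    then show "node_weight c (insert y X) i = ?w i - c * ?w i / (real y - real i)"
      unfolding node_weight_insert[OF insert.hyps i] de(1) d_def[symmetric]
      by (simp add: divide_simps de(2)) (simp add: algebra_simps)
  qed simp
  { case 1 show ?case using insert.hyps insert.IH wy w0 by (simp add: sum_subtractf) }
  have w1: "(\<Sum>i\<in>X. node_weight c (insert y X) i * real i)
     = (\<Sum>i\<in>X. ?w i * real i + c * ?w i - real y * (c * ?w i / (real y - real i)))"
  proof (rule sum.cong)
    fix i assume i: "i \<in> X"
    define d where "d = real i - real y"
    have "d \<noteq> 0" and de: "real y - real i = - d" "real i = real y + d"
      using i insert.hyps by (auto simp: d_def)
    then show "node_weight c (insert y X) i * real i
        = ?w i * real i + c * ?w i - real y * (c * ?w i / (real y - real i))"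
      unfolding node_weight_insert[OF insert.hyps i] de(1) d_def[symmetric]
      by (simp add: divide_simps de(2)) (simp add: algebra_simps)
  qed simp
  { case 2 show ?case using insert.hyps insert.IH wy
        w1[unfolded sum.distrib sum_subtractf sum_distrib_left[symmetric]]
      by (simp add: field_simps) }
qed simp_all

text \<open>The smallest node \<open>r\<close> makes the product in \<open>prod_partial_fractions\<close> vanish at \<open>r - c\<close>.\<close>

lemma sum_transition_weight:
  assumes "finite X" "r \<in> X" "c > real r"
  defines "m \<equiv> real (card X)"
    and "p \<equiv> (\<lambda>i. node_weight c X i / (real i + c - real r))"
  shows "(\<Sum>i\<in>X. p i) = 1 / c"
    and "(\<Sum>i\<in>X. p i * (real i + c - real r)) = m"
    and "(\<Sum>i\<in>X. p i * (real i + c - real r)\<^sup>2)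
      = (\<Sum>x\<in>X. real x) + c * m * (m - 1) / 2 + (c - real r) * m"
proof -
  have nz: "real i + c - real r > 0" for i using assms(3) by linarith
  have "real r - c \<notin> real ` X"
  proof
    assume "real r - c \<in> real ` X"
    then obtain i where "real r - c = real i" by auto
    then show False using assms(3) by linarith
  qed
  from prod_partial_fractions[OF assms(1) this, of c]
  have "0 = 1 + (\<Sum>i\<in>X. c * node_weight c X i / (real r - c - real i))"
    using assms(1-3) by (subst (asm) prod_zero) (auto intro!: bexI[of _ r])
  also have "(\<Sum>i\<in>X. c * node_weight c X i / (real r - c - real i)) = (\<Sum>i\<in>X. - (c * p i))"
  proof (rule sum.cong)
    fix i
    have "real r - c - real i = - (real i + c - real r)" by simp
    then show "c * node_weight c X i / (real r - c - real i) = - (c * p i)"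
      unfolding p_def by (metis divide_minus_right times_divide_eq_right)
  qed simp
  finally have "c * (\<Sum>i\<in>X. p i) = 1" by (simp add: sum_negf flip: sum_distrib_left)
  then show "(\<Sum>i\<in>X. p i) = 1 / c" using assms(3) by (simp add: field_simps)
  \<comment> \<open>One factor \<open>i + c - r\<close> cancels the denominator of
    \<open>p i\<close>, so the first and second moments reduce to
    \<open>sum_node_weight\<close>.\<close>
  have w: "p i * (real i + c - real r) = node_weight c X i" for i
    using nz[of i] by (simp add: p_def)
  then show "(\<Sum>i\<in>X. p i * (real i + c - real r)) = m"
    using sum_node_weight(1)[OF assms(1)] by (simp add: m_def)
  have "(\<Sum>i\<in>X. p i * (real i + c - real r)\<^sup>2)
    = (\<Sum>i\<in>X. node_weight c X i * real i + (c - real r) * node_weight c X i)"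
    by (rule sum.cong) (simp_all add: w[symmetric] power2_eq_square algebra_simps)
  then show "(\<Sum>i\<in>X. p i * (real i + c - real r)\<^sup>2)
      = (\<Sum>x\<in>X. real x) + c * m * (m - 1) / 2 + (c - real r) * m"
    by (simp add: sum.distrib sum_node_weight[OF assms(1)] m_def flip: sum_distrib_left)
qed

section \<open>Bead configurations\<close>

definition inversions :: "nat set \<Rightarrow> (nat \<times> nat) set" where
  "inversions X = {(a, b). a < b \<and> a \<notin> X \<and> b \<in> X}"

lemma finite_inversions:
  assumes "finite X"
  shows "finite (inversions X)"
proof -
  obtain m where "\<forall>x\<in>X. x \<le> m" using assms finite_nat_set_iff_bounded_le[of X] by auto
  then have "inversions X \<subseteq> {..m} \<times> {..m}" by (force simp: inversions_def)
  then show ?thesis by (rule finite_subset) simp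
qed

text \<open>A new bead \<open>b\<close> creates its inversions with the gaps to its left and
  destroys those with the beads to its right. Combining both sides with the pairs of
  \<open>b\<close> and all beads completes the former to all positions below \<open>b\<close>. The
  form without inverses serves both for sums and for products of natural numbers.\<close>

lemma (in comm_monoid_set) inversions_insert:
  assumes "finite Y" "b \<notin> Y"
  shows "f (F (\<lambda>(a, c). g a c) (inversions (insert b Y))) (F (\<lambda>a. g (min a b) (max a b)) Y)
    = f (F (\<lambda>(a, c). g a c) (inversions Y)) (F (\<lambda>a. g a b) {..<b})"
proof -
  let ?G = "\<lambda>(a, c). g a c"
  \<comment> \<open>\<open>?U\<close> holds the destroyed inversions, \<open>?D\<close> the created
    ones.\<close>
  let ?U = "Pair b ` {c \<in> Y. b < c}" and ?D = "(\<lambda>a. (a, b)) ` {a. a < b \<and> a \<notin> Y}"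
  have fin: "finite (inversions Y)" "finite (inversions (insert b Y))"
    using assms by (simp_all add: finite_inversions)
  have "inversions (insert b Y) \<union> ?U = inversions Y \<union> ?D"
    using assms by (auto simp: inversions_def)
  moreover have "F ?G (inversions (insert b Y) \<union> ?U) = f (F ?G (inversions (insert b Y))) (F ?G ?U)"
    using assms fin by (intro union_disjoint) (auto simp: inversions_def)
  moreover have "F ?G (inversions Y \<union> ?D) = f (F ?G (inversions Y)) (F ?G ?D)"
    using assms fin by (intro union_disjoint) (auto simp: inversions_def)
  moreover have "F ?G ?U = F (\<lambda>a. g (min a b) (max a b)) {c \<in> Y. b < c}"
    by (subst reindex) (auto intro!: inj_onI cong simp: min_def max_def)
  moreover have "F ?G ?D = F (\<lambda>a. g a b) {a. a < b \<and> a \<notin> Y}"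
    by (subst reindex) (auto intro!: inj_onI cong simp: min_def max_def)
  moreover have "F (\<lambda>a. g (min a b) (max a b)) Y
      = f (F (\<lambda>a. g (min a b) (max a b)) {c \<in> Y. b < c}) (F (\<lambda>a. g a b) {a \<in> Y. a < b})"
  proof -
    have "F (\<lambda>a. g (min a b) (max a b)) ({c \<in> Y. b < c} \<union> {a \<in> Y. a < b})
      = f (F (\<lambda>a. g (min a b) (max a b)) {c \<in> Y. b < c}) (F (\<lambda>a. g (min a b) (max a b)) {a \<in> Y. a < b})"
      using assms by (intro union_disjoint) auto
    moreover have "{c \<in> Y. b < c} \<union> {a \<in> Y. a < b} = Y"
      using assms by (auto intro: linorder_neqE_nat)
    ultimately have "F (\<lambda>a. g (min a b) (max a b)) Y
      = f (F (\<lambda>a. g (min a b) (max a b)) {c \<in> Y. b < c}) (F (\<lambda>a. g (min a b) (max a b)) {a \<in> Y. a < b})"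
      by (simp only:)
    also have "F (\<lambda>a. g (min a b) (max a b)) {a \<in> Y. a < b} = F (\<lambda>a. g a b) {a \<in> Y. a < b}"
      by (rule cong) auto
    finally show ?thesis .
  qed
  moreover have "F (\<lambda>a. g a b) {..<b}
      = f (F (\<lambda>a. g a b) {a. a < b \<and> a \<notin> Y}) (F (\<lambda>a. g a b) {a \<in> Y. a < b})"
  proof -
    have "F (\<lambda>a. g a b) ({a. a < b \<and> a \<notin> Y} \<union> {a \<in> Y. a < b})
      = f (F (\<lambda>a. g a b) {a. a < b \<and> a \<notin> Y}) (F (\<lambda>a. g a b) {a \<in> Y. a < b})"
      using assms by (intro union_disjoint) auto
    moreover have "{a. a < b \<and> a \<notin> Y} \<union> {a \<in> Y. a < b} = {..<b}" by auto
    ultimately show ?thesis by (simp only:)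
  qed
  ultimately show ?thesis by (simp only: assoc[symmetric])
qed

text \<open>The gaps below \<open>b\<close> are all positions below \<open>b\<close> minus the beads
  there; by symmetry and the zero diagonal, the double sum counts each pair of beads twice.\<close>

lemma sum_inversions:
  fixes g :: "nat \<Rightarrow> nat \<Rightarrow> real"
  assumes "finite X" "\<And>a b. g a b = g b a" "\<And>a. g a a = 0"
  shows "(\<Sum>(a, b)\<in>inversions X. g a b) = (\<Sum>b\<in>X. \<Sum>a<b. g a b) - (\<Sum>b\<in>X. \<Sum>a\<in>X. g a b) / 2"
  using assms(1)
proof (induction X rule: finite_induct)
  case (insert b Y)
  have "(\<Sum>a\<in>Y. g (min a b) (max a b)) = (\<Sum>a\<in>Y. g a b)"
    by (rule sum.cong) (auto simp: min_def max_def assms(2))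
  moreover have "(\<Sum>a\<in>Y. g b a) = (\<Sum>a\<in>Y. g a b)" using assms(2) by (intro sum.cong) auto
  ultimately show ?case using insert sum.inversions_insert[OF insert.hyps, of g]
    by (simp add: assms(3) sum.distrib field_simps)
qed (simp add: inversions_def)

definition move_bead :: "nat \<Rightarrow> nat set \<Rightarrow> nat \<Rightarrow> nat set" where
  "move_bead t X b = insert (b + t) (X - {b})"

text \<open>Both configurations arise by one insertion from the one without the bead
  \<open>b\<close>, which supplies the common part \<open>c\<close>. Gaps no longer appear outside
  \<open>inversions\<close>: only full ranges of positions and the other beads remain.\<close>

lemma (in comm_monoid_set) inversions_move_bead:
  assumes "finite X" "b \<in> X" "b + t \<notin> X"
  shows "\<exists>c. f (F (\<lambda>(a, c). g a c) (inversions (move_bead t X b)))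
        (F (\<lambda>a. g (min a (b + t)) (max a (b + t))) (X - {b})) = f c (F (\<lambda>a. g a (b + t)) {..<b + t})
    \<and> f (F (\<lambda>(a, c). g a c) (inversions X))
        (F (\<lambda>a. g (min a b) (max a b)) (X - {b})) = f c (F (\<lambda>a. g a b) {..<b})"
proof -
  have "insert b (X - {b}) = X" using assms by blast
  then show ?thesis
    using inversions_insert[of "X - {b}" "b + t" g] inversions_insert[of "X - {b}" b g] assms
    by (intro exI[of _ "F (\<lambda>(a, c). g a c) (inversions (X - {b}))"]) (simp add: move_bead_def)
qed

lemma card_inversions_move_bead:
  assumes "finite X" "b \<in> X" "b + t \<notin> X"
  shows "card (inversions (move_bead t X b)) = card (inversions X) + t"
proof -
  obtain c where "card (inversions (move_bead t X b)) + card (X - {b}) = c + (b + t)"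
    "card (inversions X) + card (X - {b}) = c + b"
    using sum.inversions_move_bead[OF assms, of "\<lambda>_ _. 1 :: nat"]
    by (simp only: split_def card_eq_sum[symmetric] card_lessThan) blast
  then show ?thesis by linarith
qed

section \<open>Hook products and the weights of bead moves\<close>

definition residue_class :: "nat \<Rightarrow> nat set \<Rightarrow> nat \<Rightarrow> nat set" where
  "residue_class t X r = {x \<in> X. x mod t = r}"

text \<open>The weight of the move from \<open>b\<close> to \<open>b + t\<close>. It is defined for
  blocked beads as well, where it vanishes, so that averages run over all beads and the partial
  fraction sums apply.\<close>

definition transition_weight :: "nat \<Rightarrow> nat set \<Rightarrow> nat \<Rightarrow> real" where
  "transition_weight t X b
    = node_weight t (residue_class t X (b mod t)) b / (real b + real t - real (b mod t))"

definition hook_prod :: "nat \<Rightarrow> nat set \<Rightarrow> nat" where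
  "hook_prod t X = (\<Prod>(a, b)\<in>inversions X. if t dvd b - a then b - a else 1)"

lemma hook_prod_pos: "hook_prod t X > 0"
  unfolding hook_prod_def by (rule prod_pos) (auto simp: inversions_def)

text \<open>The node \<open>b + t\<close> contributes the factor
  \<open>1 + t / (b - (b + t)) = 0\<close>.\<close>

lemma transition_weight_eq_0:
  assumes "finite X" "b + t \<in> X" "t > 0"
  shows "transition_weight t X b = 0"
proof -
  have "(\<Prod>x\<in>residue_class t X (b mod t) - {b}. 1 + real t / (real b - real x)) = 0"
    using assms by (intro prod_zero) (auto simp: residue_class_def intro!: bexI[of _ "b + t"])
  then show ?thesis by (simp add: transition_weight_def node_weight_def)
qed

text \<open>The positions \<open>a \<ge> t\<close> are those below \<open>b\<close> shifted by
  \<open>t\<close>; among the first \<open>t\<close> positions only \<open>b mod t\<close> lies at a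
  distance divisible by \<open>t\<close>.\<close>

lemma prod_multiples_below:
  assumes "t > 0"
  shows "(\<Prod>a<b + t. if t dvd b + t - a then b + t - a else (1 :: nat))
    = (b + t - b mod t) * (\<Prod>a<b. if t dvd b - a then b - a else 1)"
proof -
  let ?g = "\<lambda>a. if t dvd b + t - a then b + t - a else (1::nat)"
  have "{..<b + t} = {..<t} \<union> (\<lambda>a. a + t) ` {..<b}"
  proof
    show "{..<b + t} \<subseteq> {..<t} \<union> (\<lambda>a. a + t) ` {..<b}"
    proof
      fix x assume "x \<in> {..<b + t}"
      then show "x \<in> {..<t} \<union> (\<lambda>a. a + t) ` {..<b}"
        by (cases "x < t") (auto intro!: image_eqI[of _ _ "x - t"])
    qed
  qed auto
  then have "(\<Prod>a<b + t. ?g a) = (\<Prod>a<t. ?g a) * (\<Prod>a\<in>(\<lambda>a. a + t) ` {..<b}. ?g a)"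
    by (subst prod.union_disjoint[symmetric]) auto
  also have "(\<Prod>a\<in>(\<lambda>a. a + t) ` {..<b}. ?g a) = (\<Prod>a<b. if t dvd b - a then b - a else 1)"
    by (subst prod.reindex) (auto simp: inj_on_def intro!: prod.cong)
  also have "(\<Prod>a<t. ?g a) = (\<Prod>a\<in>{b mod t}. ?g a)"
  proof (rule prod.mono_neutral_right)
    show "\<forall>a\<in>{..<t} - {b mod t}. ?g a = 1"
    proof
      fix a assume a: "a \<in> {..<t} - {b mod t}"
      have "\<not> t dvd b + t - a"
      proof
        assume "t dvd b + t - a"
        moreover have "a \<le> b + t" using a by auto
        ultimately have "(b + t) mod t = a mod t" using mod_eq_dvd_iff_nat by blast
        then show False using a by auto
      qed
      then show "?g a = 1" by simp
    qed
  qed (use assms in auto)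
  also have "\<dots> = b + t - b mod t"
  proof -
    have "b + t - b mod t = t * (b div t) + t" using minus_mod_eq_mult_div[of b t] 
      by (metis Nat.add_diff_assoc2 mod_less_eq_dividend)
    then show ?thesis by simp
  qed
  finally show ?thesis .
qed

text \<open>The pair of the moved bead with another bead \<open>a\<close> of its residue class
  changes by \<open>(b + t - a) / (b - a)\<close>, a factor of \<open>node_weight\<close>; beads of
  other classes change nothing. The extra multiple from \<open>prod_multiples_below\<close> is the
  denominator of the weight.\<close>

lemma hook_prod_move_bead:
  assumes "finite X" "b \<in> X" "b + t \<notin> X" "t > 0"
  shows "real (hook_prod t X) / real (hook_prod t (move_bead t X b)) = transition_weight t X b"
proof -
  let ?g = "\<lambda>a c. if t dvd c - a then c - a else (1::nat)"
  let ?R = "\<lambda>c. \<Prod>a\<in>X - {b}. ?g (min a c) (max a c)"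
  let ?B = "\<Prod>a<b. ?g a b"
  obtain c where c: "hook_prod t (move_bead t X b) * ?R (b + t) = c * ((b + t - b mod t) * ?B)"
    "hook_prod t X * ?R b = c * ?B"
    using prod.inversions_move_bead[OF assms(1-3), of ?g] prod_multiples_below[OF assms(4)]
    unfolding hook_prod_def by metis
  have pos: "?R b > 0"
    by (rule prod_pos) (auto simp: min_def max_def)
  have "real (?R (b + t)) / real (?R b)
    = (\<Prod>a\<in>X - {b}. real (?g (min a (b + t)) (max a (b + t))) / real (?g (min a b) (max a b)))"
    by (simp add: prod_dividef)
  also have "\<dots> = (\<Prod>a\<in>X - {b}. if a mod t = b mod t then 1 + real t / (real b - real a) else 1)"
  proof (rule prod.cong)
    fix a assume a: "a \<in> X - {b}"
    show "real (?g (min a (b + t)) (max a (b + t))) / real (?g (min a b) (max a b))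
      = (if a mod t = b mod t then 1 + real t / (real b - real a) else 1)"
    proof (cases "a < b")
      case True
      moreover have "t dvd b + t - a \<longleftrightarrow> a mod t = b mod t"
        using True mod_eq_dvd_iff_nat[of a "b + t" t] by auto
      moreover have "t dvd b - a \<longleftrightarrow> a mod t = b mod t"
        using True mod_eq_dvd_iff_nat[of a b t] by auto
      ultimately show ?thesis by (auto simp: of_nat_diff field_simps)
    next
      case False
      then have ab: "b < a" using a by auto
      have d: "t dvd a - b \<longleftrightarrow> a mod t = b mod t"
        using ab mod_eq_dvd_iff_nat[of b a t] by auto
      show ?thesis
      proof (cases "a mod t = b mod t")
        case True
        then have "t \<le> a - b" using d ab by (auto intro: dvd_imp_le)
        \<comment> \<open>Equality is excluded because \<open>b + t\<close> is free, so the move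
          does not change the order of the two beads.\<close>
        then have "b + t < a" using a assms(3) ab by (metis DiffD1 le_add_diff_inverse nat_add_left_cancel_le less_imp_le le_neq_implies_less)
        moreover from this have "t dvd a - (b + t)" using True mod_eq_dvd_iff_nat[of "b + t" a t] by auto
        ultimately show ?thesis using True d by (simp add: min_def max_def of_nat_diff field_simps)
      next
        case False
        have "\<not> t dvd (max a (b + t) - min a (b + t))"
        proof
          assume *: "t dvd (max a (b + t) - min a (b + t))"
          show False
          proof (cases "a \<le> b + t")
            case True
            then show False using * \<open>a mod t \<noteq> b mod t\<close> mod_eq_dvd_iff_nat[of a "b + t" t] by auto
          next
            case False
            then show False using * \<open>a mod t \<noteq> b mod t\<close> mod_eq_dvd_iff_nat[of "b + t" a t] by auto
          qed
        qed
        then show ?thesis using False d ab by simp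
      qed
    qed
  qed simp
  also have "\<dots> = node_weight t (residue_class t X (b mod t)) b"
    unfolding node_weight_def residue_class_def using assms
    by (subst prod.inter_filter[symmetric]) (auto intro!: prod.cong)
  finally have R: "real (?R (b + t)) / real (?R b) = node_weight t (residue_class t X (b mod t)) b" .
  have r: "real (b + t - b mod t) = real b + real t - real (b mod t)"
    by (simp add: of_nat_diff trans_le_add1)
  have rpos: "real (b + t - b mod t) > 0" using assms(4) mod_less_divisor[of t b] by linarith
  have "hook_prod t (move_bead t X b) * ?R (b + t) = hook_prod t X * ?R b * (b + t - b mod t)"
    unfolding c by (simp only: mult_ac)
  from arg_cong[OF this, of real]
  have "real (hook_prod t (move_bead t X b)) * real (?R (b + t))
      = real (hook_prod t X) * real (?R b) * real (b + t - b mod t)"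
    by (simp only: of_nat_mult)
  moreover have "h / h' = R' / R / u" if "h' * R' = h * R * u" "h' > 0" "R > 0" "u > 0" for h h' R R' u :: real
    using that by (simp add: field_simps)
  ultimately have "real (hook_prod t X) / real (hook_prod t (move_bead t X b))
     = real (?R (b + t)) / real (?R b) / real (b + t - b mod t)"
    using hook_prod_pos[of t "move_bead t X b"] pos rpos by (simp only: of_nat_0_less_iff)
  then show ?thesis unfolding R transition_weight_def r .
qed

section \<open>Increments of the squared hook lengths\<close>

lemma (in comm_monoid_set) lessThan_add_split:
  "F g {..<b + t} = f (F g {..<t}) (F (\<lambda>a. g (a + t)) {..<b :: nat})"
  by (induction b) (simp_all add: lessThan_Suc ac_simps)

lemma mod_eq_add_iff:
  fixes a b k t :: nat
  assumes "k \<le> t"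
  shows "a mod t = (b + k) mod t \<longleftrightarrow> b mod t = (a + (t - k)) mod t"
proof -
  have *: "b mod t = (a + (t - k)) mod t" if "k \<le> t" "a mod t = (b + k) mod t" for a b k :: nat
  proof -
    have "(a + (t - k)) mod t = (b + k + (t - k)) mod t" using that(2) by (metis mod_add_left_eq)
    then show ?thesis using that(1) by simp
  qed
  show ?thesis using *[of k a b] *[of "t - k" b a] assms by auto
qed

text \<open>Rotation of the residues by \<open>t - k\<close> inverts rotation by
  \<open>k\<close>.\<close>

lemma sum_lessThan_rotate:
  fixes h :: "nat \<Rightarrow> nat \<Rightarrow> real"
  assumes "k \<le> t"
  shows "(\<Sum>r<t. h r ((r + k) mod t)) = (\<Sum>r<t. h ((r + (t - k)) mod t) r)"
proof (rule sum.reindex_bij_witness[where i = "\<lambda>r. (r + (t - k)) mod t" and j = "\<lambda>r. (r + k) mod t"])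
  fix r assume "r \<in> {..<t}"
  then have r: "r < t" by auto
  have "((r + k) mod t + (t - k)) mod t = (r + k + (t - k)) mod t" by (rule mod_add_left_eq)
  then show *: "((r + k) mod t + (t - k)) mod t = r" using r assms by simp
  have "((r + (t - k)) mod t + k) mod t = (r + (t - k) + k) mod t" by (rule mod_add_left_eq)
  then show "((r + (t - k)) mod t + k) mod t = r" using r assms by simp
  show "(r + k) mod t \<in> {..<t}" "(r + (t - k)) mod t \<in> {..<t}" using r by auto
  show "h (((r + k) mod t + (t - k)) mod t) ((r + k) mod t) = h r ((r + k) mod t)" using * by simp
qed

text \<open>Rotation changes \<open>t - k\<close> residues by \<open>k\<close> and the other
  \<open>k\<close> residues by \<open>k - t\<close>.\<close>

lemma sum_rotate_diff_squared:
  assumes "k \<le> t"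
  shows "(\<Sum>r<t. (real r - real ((r + k) mod t))\<^sup>2) = real k * real t * (real t - real k)"
proof -
  have "{..<t} = {..<t - k} \<union> {t - k..<t}" by auto
  then have "(\<Sum>r<t. (real r - real ((r + k) mod t))\<^sup>2)
    = (\<Sum>r<t - k. (real r - real ((r + k) mod t))\<^sup>2) + (\<Sum>r\<in>{t - k..<t}. (real r - real ((r + k) mod t))\<^sup>2)"
    by (simp only: sum.union_disjoint[of "{..<t - k}" "{t - k..<t}"] finite_lessThan
        finite_atLeastLessThan ivl_disj_int_one)
  also have "(\<Sum>r<t - k. (real r - real ((r + k) mod t))\<^sup>2) = (\<Sum>r<t - k. (real k)\<^sup>2)"
    by (rule sum.cong) auto
  also have "(\<Sum>r\<in>{t - k..<t}. (real r - real ((r + k) mod t))\<^sup>2)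
    = (\<Sum>r\<in>{t - k..<t}. (real t - real k)\<^sup>2)"
  proof (rule sum.cong)
    fix r assume r: "r \<in> {t - k..<t}"
    then have "t \<le> r + k" "r + k - t < t" using assms by auto
    then have "(r + k) mod t = r + k - t" by (simp add: le_mod_geq)
    then have "real ((r + k) mod t) = real r + real k - real t"
      using \<open>t \<le> r + k\<close> by (simp add: of_nat_diff)
    then show "(real r - real ((r + k) mod t))\<^sup>2 = (real t - real k)\<^sup>2" by simp
  qed simp
  finally show ?thesis using assms by (simp add: of_nat_diff power2_eq_square algebra_simps)
qed

text \<open>The fraction counts the complete periods below \<open>b\<close>; the indicator belongs
  to the incomplete last one.\<close>

lemma sum_of_bool_residue:
  assumes "t > 0" "q < t"
  shows "(\<Sum>a<b. of_bool (a mod t = q)) = (real b - real (b mod t)) / real t + of_bool (q < b mod t)"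
proof (induction b)
  case (Suc b)
  show ?case
  proof (cases "Suc (b mod t) = t")
    case True
    then have *: "Suc b mod t = 0" "real (b mod t) = real t - 1" by (auto simp: mod_Suc)
    have "(q < b mod t) = (b mod t \<noteq> q)" using True assms(2) by auto
    then show ?thesis using Suc * assms(1) by (auto simp: field_simps)
  next
    case False
    then have "Suc b mod t = Suc (b mod t)" by (simp add: mod_Suc)
    then show ?thesis using Suc assms(1) by (auto simp: field_simps)
  qed
qed simp

text \<open>
  For \<open>a \<le> b\<close> this counts the congruences \<open>b - a \<equiv> k\<close> and \<open>b - a \<equiv> t - k\<close>, with value 2 if both hold
  because \<open>2 * k = t\<close>. It is symmetric in \<open>a\<close> and \<open>b\<close>, which neither congruence is.
\<close>

definition residue_adj :: "nat \<Rightarrow> nat \<Rightarrow> nat \<Rightarrow> nat \<Rightarrow> real" where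
  "residue_adj t k a b = of_bool (a mod t = (b + k) mod t) + of_bool (a mod t = (b + (t - k)) mod t)"

lemma residue_adj_commute:
  assumes "k \<le> t"
  shows "residue_adj t k a b = residue_adj t k b a"
  using mod_eq_add_iff[OF assms, of a b] mod_eq_add_iff[of "t - k" t a b] assms
  by (simp add: residue_adj_def)

lemma residue_adj_self:
  assumes "0 < k" "k < t"
  shows "residue_adj t k a a = 0"
proof -
  have *: "a mod t \<noteq> (a + j) mod t" if "0 < j" "j < t" for j
  proof
    assume "a mod t = (a + j) mod t"
    then have "t dvd j" using mod_eq_dvd_iff_nat[of a "a + j" t] by auto
    then show False using that by (auto dest: dvd_imp_le)
  qed
  show ?thesis using *[of k] *[of "t - k"] assms by (simp add: residue_adj_def)
qed

lemma residue_adj_eq: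
  assumes "a \<le> b" "k \<le> t"
  shows "residue_adj t k a b = of_bool ([b - a = k] (mod t)) + of_bool ([b - a = t - k] (mod t))"
proof -
  have *: "[b - a = j] (mod t) \<longleftrightarrow> b mod t = (a + j) mod t" for j
    using cong_add_lcancel_nat[of a "b - a" j t] assms(1) by (simp add: cong_def)
  show ?thesis using * residue_adj_commute[OF assms(2), of a b] by (simp add: residue_adj_def)
qed

lemma residue_adj_add [simp]: "residue_adj t k a (b + t) = residue_adj t k a b"
proof -
  have "(b + t + j) mod t = (b + j) mod t" for j
    by (metis add.assoc add.commute mod_add_self2)
  then show ?thesis by (simp add: residue_adj_def)
qed

lemma sum_residue_adj:
  assumes "finite X"
  shows "(\<Sum>a\<in>X. residue_adj t k a b * h a)
    = (\<Sum>a\<in>residue_class t X ((b + k) mod t). h a) + (\<Sum>a\<in>residue_class t X ((b + (t - k)) mod t). h a)"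
proof -
  have *: "(\<Sum>a\<in>X. of_bool (a mod t = q) * h a) = (\<Sum>a\<in>residue_class t X q. h a)" for q
    unfolding residue_class_def sum.inter_filter[OF assms] by (intro sum.cong) auto
  show ?thesis by (simp add: residue_adj_def distrib_right sum.distrib *)
qed

section \<open>The increment for a single bead move\<close>

definition hook_square_sum :: "nat \<Rightarrow> nat \<Rightarrow> nat set \<Rightarrow> real" where
  "hook_square_sum t k X = (\<Sum>(a, b)\<in>inversions X. residue_adj t k a b * (real b - real a)\<^sup>2)"

definition hook_count :: "nat \<Rightarrow> nat \<Rightarrow> nat set \<Rightarrow> real" where
  "hook_count t k X = (\<Sum>(a, b)\<in>inversions X. residue_adj t k a b)"

text \<open>Share of the runner of \<open>b + j\<close> in the increment when \<open>b\<close> moves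
  to \<open>b + t\<close>. The square belongs to the one extra position of that runner below
  \<open>b + t\<close>; the sum subtracts \<open>(b + t - a)^2 - (b - a)^2\<close> for each bead
  \<open>a\<close> of the runner, on either side of \<open>b\<close>.\<close>

definition bead_gain :: "nat \<Rightarrow> nat set \<Rightarrow> nat \<Rightarrow> nat \<Rightarrow> real" where
  "bead_gain t X j b = (real b + real t - real ((b + j) mod t))\<^sup>2
    - (\<Sum>a\<in>residue_class t X ((b + j) mod t). real t * (2 * (real b - real a) + real t))"

lemma hook_square_sum_move_bead:
  assumes "finite X" "b \<in> X" "b + t \<notin> X" "0 < k" "k < t"
  shows "hook_square_sum t k (move_bead t X b) - hook_square_sum t k X
    = bead_gain t X k b + bead_gain t X (t - k) b"
proof -
  let ?g = "\<lambda>a c. residue_adj t k a c * (real c - real a)\<^sup>2"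
  have g_minmax: "?g (min a c) (max a c) = ?g a c" for a c
    using residue_adj_commute[of k t a c] assms(5)
    by (auto simp: min_def max_def power2_commute)
  obtain c where c: "hook_square_sum t k (move_bead t X b) + (\<Sum>a\<in>X - {b}. ?g a (b + t))
      = c + (\<Sum>a<b + t. ?g a (b + t))"
    "hook_square_sum t k X + (\<Sum>a\<in>X - {b}. ?g a b) = c + (\<Sum>a<b. ?g a b)"
    using sum.inversions_move_bead[OF assms(1-3), of ?g]
    unfolding hook_square_sum_def g_minmax by blast
  have adj_shift: "residue_adj t k (a + t) b = residue_adj t k a b" for a b
    using residue_adj_add residue_adj_commute assms(5) by (metis less_imp_le)
  \<comment> \<open>A shift of both arguments by \<open>t\<close> preserves the summand, so only the
    positions \<open>a < t\<close> are new; each residue occurs once among them.\<close>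
  have "(\<Sum>a<b + t. ?g a (b + t)) = (\<Sum>a<t. ?g a (b + t)) + (\<Sum>a<b. ?g a b)"
    by (subst sum.lessThan_add_split) (simp add: adj_shift)
  also have "(\<Sum>a<t. ?g a (b + t)) = (\<Sum>a<t. residue_adj t k a b * (real b + real t - real a)\<^sup>2)"
    by simp
  also have "\<dots> = (real b + real t - real ((b + k) mod t))\<^sup>2
      + (real b + real t - real ((b + (t - k)) mod t))\<^sup>2"
  proof -
    have "residue_class t {..<t} (x mod t) = {x mod t}" for x
      using assms(5) by (auto simp: residue_class_def)
    then show ?thesis by (subst sum_residue_adj) simp_all
  qed
  finally have L: "(\<Sum>a<b + t. ?g a (b + t)) - (\<Sum>a<b. ?g a b)
    = (real b + real t - real ((b + k) mod t))\<^sup>2 + (real b + real t - real ((b + (t - k)) mod t))\<^sup>2"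
    by simp
  have "(\<Sum>a\<in>X - {b}. ?g a (b + t)) - (\<Sum>a\<in>X - {b}. ?g a b)
      = (\<Sum>a\<in>X - {b}. residue_adj t k a b * (real t * (2 * (real b - real a) + real t)))"
    unfolding sum_subtractf[symmetric]
    by (rule sum.cong) (auto simp: power2_eq_square algebra_simps)
  \<comment> \<open>The bead \<open>b\<close> may be included because \<open>0 < k < t\<close> makes
    its adjacency to itself 0.\<close>
  also have "\<dots> = (\<Sum>a\<in>X. residue_adj t k a b * (real t * (2 * (real b - real a) + real t)))"
    using assms by (subst sum.remove[of X b]) (simp_all add: residue_adj_self)
  finally show ?thesis using c L unfolding bead_gain_def sum_residue_adj[OF assms(1)] by linarith
qed


section \<open>Averages over all beads\<close>

lemma sum_by_residue:
  fixes h :: "nat \<Rightarrow> real"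
  assumes "finite X" "t > 0"
  shows "(\<Sum>b\<in>X. h b) = (\<Sum>r<t. \<Sum>b\<in>residue_class t X r. h b)"
  unfolding residue_class_def using assms by (subst sum.group) auto

text \<open>On the runner \<open>r\<close> the gain is a quadratic polynomial in \<open>b\<close>.
  Expanded in powers of \<open>b + t - r\<close>, it is averaged by the three moments of
  \<open>sum_transition_weight\<close>. The result is linear in the bead sums \<open>s\<close>; the
  rest depends only on the numbers \<open>m\<close> of beads.\<close>

lemma sum_transition_bead_gain:
  fixes t r j :: nat and X :: "nat set" and m s :: "nat \<Rightarrow> real"
  assumes "finite X" "r \<in> X" "r < t"
  defines "q \<equiv> (r + j) mod t"
    and "m \<equiv> \<lambda>r. real (card (residue_class t X r))" and "s \<equiv> \<lambda>r. \<Sum>x\<in>residue_class t X r. real x"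
  shows "(\<Sum>b\<in>residue_class t X r. transition_weight t X b * bead_gain t X j b)
    = s r + 2 * s q + (t * m r * (m r - 1) / 2 + (t - real r) * m r + 2 * (real r - real q) * m r
        + (real r - real q)\<^sup>2 / t - 2 * t * m q * m r - m q * (2 * real r - t))"
proof -
  let ?C = "residue_class t X r"
  let ?p = "\<lambda>i. node_weight t ?C i / (real i + real t - real r)"
  have C: "finite ?C" "r \<in> ?C" "real t > real r"
    using assms by (auto simp: residue_class_def)
  note mom = sum_transition_weight[OF C]
  have "(\<Sum>b\<in>?C. transition_weight t X b * bead_gain t X j b)
    = (\<Sum>b\<in>?C. ?p b * (real b + real t - real r)\<^sup>2
        + (2 * (real r - real q) - 2 * t * m q) * (?p b * (real b + real t - real r))
        + ((real r - real q)\<^sup>2 - t * m q * (2 * real r - t) + 2 * t * s q) * ?p b)"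
  proof (rule sum.cong)
    fix b assume "b \<in> ?C"
    then have b: "b mod t = r" by (auto simp: residue_class_def)
    then have "(b + j) mod t = q" unfolding q_def by (metis mod_add_left_eq)
    moreover have "(\<Sum>a\<in>residue_class t X q. real t * (2 * (real b - real a) + real t))
      = t * m q * (2 * real b + t) - 2 * t * s q"
    proof -
      have "(\<Sum>a\<in>residue_class t X q. real t * (2 * (real b - real a) + real t))
        = (\<Sum>a\<in>residue_class t X q. t * (2 * real b + t) - 2 * t * real a)"
        by (rule sum.cong) (simp_all add: algebra_simps)
      then show ?thesis unfolding m_def s_def sum_subtractf sum_distrib_left by simp
    qed
    ultimately have "bead_gain t X j b = (real b + real t - real q)\<^sup>2 - (t * m q * (2 * real b + t) - 2 * t * s q)"
      by (simp add: bead_gain_def)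
    moreover have "transition_weight t X b = ?p b" by (simp add: transition_weight_def b)
    moreover have "P * ((real b + real t - real q)\<^sup>2 - (t * m q * (2 * real b + t) - 2 * t * s q))
      = P * (real b + real t - real r)\<^sup>2
        + (2 * (real r - real q) - 2 * t * m q) * (P * (real b + real t - real r))
        + ((real r - real q)\<^sup>2 - t * m q * (2 * real r - t) + 2 * t * s q) * P" for P :: real
      by (simp add: power2_eq_square algebra_simps)
    ultimately show "transition_weight t X b * bead_gain t X j b
      = ?p b * (real b + real t - real r)\<^sup>2
        + (2 * (real r - real q) - 2 * t * m q) * (?p b * (real b + real t - real r))
        + ((real r - real q)\<^sup>2 - t * m q * (2 * real r - t) + 2 * t * s q) * ?p b"
      by (simp only:)
  qed simp
  also have "\<dots> = (s r + t * m r * (m r - 1) / 2 + (t - real r) * m r)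
      + (2 * (real r - real q) - 2 * t * m q) * m r
      + ((real r - real q)\<^sup>2 - t * m q * (2 * real r - t) + 2 * t * s q) * (1 / t)"
    unfolding sum.distrib sum_distrib_left[symmetric] mom m_def s_def ..
  finally show ?thesis using C(3) by (simp add: field_simps)
qed

text \<open>
  The part of the mean increment that depends only on the number \<open>m r\<close> of beads in each residue
  class \<open>r\<close>.
\<close>

definition charge_gain :: "nat \<Rightarrow> nat \<Rightarrow> (nat \<Rightarrow> real) \<Rightarrow> real" where
  "charge_gain t j m = (\<Sum>r<t. let q = (r + j) mod t in
     t * m r * (m r - 1) / 2 + (t - real r) * m r + 2 * (real r - real q) * m r
        + (real r - real q)\<^sup>2 / t - 2 * t * m q * m r - m q * (2 * real r - t))"

definition expected_gain :: "nat \<Rightarrow> nat \<Rightarrow> nat set \<Rightarrow> real" where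
  "expected_gain t k X = (\<Sum>b\<in>X. transition_weight t X b * (bead_gain t X k b + bead_gain t X (t - k) b))"

text \<open>Each of the \<open>t\<close> residue classes has total weight \<open>1 / t\<close>;
  \<open>{..<t} \<subseteq> X\<close> provides the smallest node \<open>r\<close> that
  \<open>sum_transition_weight\<close> asks for.\<close>

lemma sum_transition_weight_eq_1:
  assumes "finite X" "{..<t} \<subseteq> X" "t > 0"
  shows "(\<Sum>b\<in>X. transition_weight t X b) = 1"
proof -
  have "(\<Sum>b\<in>residue_class t X r. transition_weight t X b) = 1 / t" if "r < t" for r
  proof -
    have C: "finite (residue_class t X r)" "r \<in> residue_class t X r" "real t > real r"
      using assms that by (auto simp: residue_class_def)
    have "(\<Sum>b\<in>residue_class t X r. transition_weight t X b)
      = (\<Sum>b\<in>residue_class t X r. node_weight t (residue_class t X r) b / (real b + real t - real r))"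
      by (rule sum.cong) (auto simp: transition_weight_def residue_class_def)
    then show ?thesis using sum_transition_weight(1)[OF C] by simp
  qed
  then show ?thesis using assms by (simp add: sum_by_residue[OF assms(1,3)])
qed

text \<open>Summed over \<open>r\<close>, the terms \<open>s r + 2 * s q\<close> give three times
  the bead sum, since the rotation permutes the runners; the shifts \<open>k\<close> and
  \<open>t - k\<close> together give six.\<close>

lemma expected_gain_eq:
  fixes t k :: nat and X :: "nat set" and m :: "nat \<Rightarrow> real"
  assumes "finite X" "{..<t} \<subseteq> X" "k \<le> t" "t > 0"
  defines "m \<equiv> \<lambda>r. real (card (residue_class t X r))"
  shows "expected_gain t k X = 6 * (\<Sum>x\<in>X. real x) + charge_gain t k m + charge_gain t (t - k) m"
proof -
  let ?s = "\<lambda>r. \<Sum>x\<in>residue_class t X r. real x"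
  have s: "(\<Sum>r<t. ?s r) = (\<Sum>x\<in>X. real x)" by (simp add: sum_by_residue[OF assms(1,4)])
  have "(\<Sum>b\<in>X. transition_weight t X b * bead_gain t X j b) = 3 * (\<Sum>x\<in>X. real x) + charge_gain t j m"
    if "j \<le> t" for j
  proof -
    have "(\<Sum>b\<in>X. transition_weight t X b * bead_gain t X j b)
      = (\<Sum>r<t. \<Sum>b\<in>residue_class t X r. transition_weight t X b * bead_gain t X j b)"
      by (rule sum_by_residue[OF assms(1,4)])
    also have "\<dots> = (\<Sum>r<t. ?s r + 2 * ?s ((r + j) mod t) + (let q = (r + j) mod t in
     t * m r * (m r - 1) / 2 + (t - real r) * m r + 2 * (real r - real q) * m r
        + (real r - real q)\<^sup>2 / t - 2 * t * m q * m r - m q * (2 * real r - t)))"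
      unfolding Let_def m_def using assms(2)
      by (intro sum.cong refl sum_transition_bead_gain[OF assms(1)]) auto
    also have "\<dots> = (\<Sum>r<t. ?s r) + 2 * (\<Sum>r<t. ?s ((r + j) mod t)) + charge_gain t j m"
      unfolding charge_gain_def sum.distrib sum_distrib_left by simp
    also have "(\<Sum>r<t. ?s ((r + j) mod t)) = (\<Sum>r<t. ?s r)"
      by (rule sum_lessThan_rotate[OF that])
    finally show ?thesis using s by simp
  qed
  from this[of k] this[of "t - k"] show ?thesis
    using assms(3) by (simp add: expected_gain_def distrib_left sum.distrib)
qed

lemma card_residue_class_move_bead:
  assumes "finite X" "b \<in> X" "b + t \<notin> X"
  shows "card (residue_class t (move_bead t X b) r) = card (residue_class t X r)"
proof (cases "b mod t = r")
  case True
  then have "residue_class t (move_bead t X b) r = insert (b + t) (residue_class t X r - {b})"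
    by (auto simp: residue_class_def move_bead_def)
  moreover have "b \<in> residue_class t X r" "b + t \<notin> residue_class t X r" "finite (residue_class t X r)"
    using True assms by (auto simp: residue_class_def)
  ultimately show ?thesis using card.remove[of "residue_class t X r" b] by simp
next
  case False
  then have "residue_class t (move_bead t X b) r = residue_class t X r"
    by (auto simp: residue_class_def move_bead_def)
  then show ?thesis by simp
qed

text \<open>A move keeps the number of beads on each runner, hence the charge part, and raises the
  bead sum by \<open>t\<close>. The condition \<open>t \<le> b\<close> keeps the first
  \<open>t\<close> positions filled.\<close>

lemma expected_gain_move_bead:
  assumes "finite X" "b \<in> X" "b + t \<notin> X" "{..<t} \<subseteq> X" "t \<le> b" "k \<le> t" "t > 0"
  shows "expected_gain t k (move_bead t X b) = expected_gain t k X + 6 * t"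
proof -
  have "(\<Sum>x\<in>move_bead t X b. real x) = (\<Sum>x\<in>X. real x) + t"
    using assms(1-3) by (simp add: move_bead_def sum.remove[of X b])
  moreover have "finite (move_bead t X b)" "{..<t} \<subseteq> move_bead t X b"
    using assms by (auto simp: move_bead_def)
  ultimately show ?thesis using assms card_residue_class_move_bead[OF assms(1-3)]
    by (simp add: expected_gain_eq)
qed

section \<open>Evaluation at the core\<close>

text \<open>By the second assumption no bead has a gap \<open>t\<close> places to its left, so the
  beads of the runner are the first \<open>m\<close> terms of the progression
  \<open>r, r + t, r + 2 * t, ...\<close>.\<close>

lemma sum_residue_class_core:
  fixes t r :: nat and m :: real
  assumes "finite X" "\<And>x. x \<in> X \<Longrightarrow> t \<le> x \<Longrightarrow> x - t \<in> X" "r < t"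
  defines "m \<equiv> real (card (residue_class t X r))"
  shows "(\<Sum>x\<in>residue_class t X r. real x) = real r * m + t * m * (m - 1) / 2"
proof -
  let ?f = "\<lambda>i. r + t * i"
  define I where "I = {i. ?f i \<in> X}"
  have inj: "inj ?f" using assms(3) by (auto simp: inj_on_def)
  have C: "residue_class t X r = ?f ` I"
  proof
    show "residue_class t X r \<subseteq> ?f ` I"
    proof
      fix x assume "x \<in> residue_class t X r"
      then have "x = ?f (x div t)" "x \<in> X" by (auto simp: residue_class_def)
      then show "x \<in> ?f ` I" unfolding I_def by (metis image_eqI mem_Collect_eq)
    qed
  qed (use assms(3) in \<open>auto simp: residue_class_def I_def\<close>)
  have fin: "finite I" unfolding I_def by (rule finite_vimageI[OF assms(1) inj, unfolded vimage_def])
  have down: "i \<in> I" if "Suc i \<in> I" for i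
    using assms(2)[of "?f (Suc i)"] that by (simp add: I_def)
  have down': "i \<in> I" if "i + d \<in> I" for i d
    using that by (induction d) (auto intro: down)
  have I: "I = {..<card I}"
  proof (rule card_subset_eq[symmetric])
    show "{..<card I} \<subseteq> I"
    proof
      fix i assume i: "i \<in> {..<card I}"
      show "i \<in> I"
      proof (rule ccontr)
        assume "i \<notin> I"
        then have "I \<subseteq> {..<i}" using down' by (metis le_add_diff_inverse lessThan_iff not_le subsetI)
        then have "card I \<le> i" using card_mono[of "{..<i}" I] by simp
        then show False using i by simp
      qed
    qed
  qed (use fin in auto)
  have m: "m = card I" unfolding m_def C using inj by (simp add: card_image inj_on_subset)
  have gs: "(\<Sum>i<n. real (r + t * i)) = real r * real n + t * real n * (real n - 1) / 2" for n
    by (induction n) (simp_all add: field_simps)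
  have "(\<Sum>x\<in>residue_class t X r. real x) = (\<Sum>i\<in>I. real (?f i))"
    unfolding C using inj by (subst sum.reindex) (auto intro: inj_on_subset)
  also have "\<dots> = real r * m + t * m * (m - 1) / 2" unfolding m using gs I by metis
  finally show ?thesis .
qed

text \<open>Both sides reduce to the same quantities: the bead sum, the number \<open>N\<close> of
  beads, the sums \<open>A\<close> of rotated residues weighted by bead numbers, and the
  correlations \<open>B\<close> of bead numbers. None of these is evaluated.\<close>

lemma expected_gain_core:
  assumes "finite X" "{..<t} \<subseteq> X" "\<And>x. x \<in> X \<Longrightarrow> t \<le> x \<Longrightarrow> x - t \<in> X" "0 < k" "k < t"
  shows "expected_gain t k X = 4 * t * hook_count t k X + 2 * real k * (real t - real k)"
proof -
  have t: "t > 0" and kt: "k \<le> t" using assms by auto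
  define m where "m r = real (card (residue_class t X r))" for r
  define s where "s r = (\<Sum>x\<in>residue_class t X r. real x)" for r
  define q where "q j r = (r + j) mod t" for j r :: nat
  define A where "A j = (\<Sum>r<t. real (q j r) * m r)" for j
  define B where "B j = (\<Sum>r<t. m (q j r) * m r)" for j
  define N where "N = (\<Sum>r<t. m r)"
  have by_res: "(\<Sum>b\<in>X. h (b mod t)) = (\<Sum>r<t. h r * m r)" for h :: "nat \<Rightarrow> real"
    unfolding sum_by_residue[OF assms(1) t]
    by (rule sum.cong) (auto simp: m_def residue_class_def)
  have S: "(\<Sum>r<t. s r) = (\<Sum>x\<in>X. real x)" by (simp add: s_def sum_by_residue[OF assms(1) t])
  \<comment> \<open>On a core \<open>t * m r * (m r - 1) / 2\<close> equals
    \<open>s r - r * m r\<close>, which trades the quadratic term for the bead sum.\<close>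
  have charge: "charge_gain t j m = (\<Sum>x\<in>X. real x) + 2 * t * N - 2 * A j - 2 * A (t - j)
      + real j * (real t - real j) - 2 * t * B j" if "j \<le> t" for j
  proof -
    have "charge_gain t j m = (\<Sum>r<t. s r + t * m r + t * m (q j r) - 2 * (real (q j r) * m r)
        - 2 * (real r * m (q j r)) + (real r - real (q j r))\<^sup>2 / t - 2 * t * (m (q j r) * m r))"
      unfolding charge_gain_def Let_def
    proof (rule sum.cong)
      fix r assume "r \<in> {..<t}"
      then have "s r = real r * m r + t * m r * (m r - 1) / 2"
        unfolding s_def m_def using sum_residue_class_core[OF assms(1,3)] by auto
      then show "real t * m r * (m r - 1) / 2 + (real t - real r) * m r
         + 2 * (real r - real ((r + j) mod t)) * m r + (real r - real ((r + j) mod t))\<^sup>2 / real t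
         - 2 * real t * m ((r + j) mod t) * m r - m ((r + j) mod t) * (2 * real r - real t)
        = s r + t * m r + t * m (q j r) - 2 * (real (q j r) * m r)
        - 2 * (real r * m (q j r)) + (real r - real (q j r))\<^sup>2 / t - 2 * t * (m (q j r) * m r)"
        by (simp add: q_def algebra_simps)
    qed simp
    also have "\<dots> = (\<Sum>r<t. s r) + t * N + t * (\<Sum>r<t. m (q j r)) - 2 * A j
        - 2 * (\<Sum>r<t. real r * m (q j r)) + (\<Sum>r<t. (real r - real (q j r))\<^sup>2) / t - 2 * t * B j"
      unfolding sum.distrib sum_subtractf A_def B_def N_def sum_distrib_left sum_divide_distrib by simp
    also have "(\<Sum>r<t. m (q j r)) = N"
      unfolding q_def N_def using sum_lessThan_rotate[OF that, of "\<lambda>_ r. m r"] by simp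
    also have "(\<Sum>r<t. real r * m (q j r)) = A (t - j)"
      unfolding q_def A_def using sum_lessThan_rotate[OF that, of "\<lambda>r r'. real r * m r'"] by simp
    also have "(\<Sum>r<t. (real r - real (q j r))\<^sup>2) = real j * real t * (real t - real j)"
      unfolding q_def by (rule sum_rotate_diff_squared[OF that])
    finally show ?thesis using S t by simp
  qed
  \<comment> \<open>The indicators from \<open>sum_of_bool_residue\<close> mark where a rotation
    wraps around. A rotated residue is \<open>r\<close> plus the shift minus \<open>t\<close> times
    that indicator, which makes the count linear in the rotated residues.\<close>
  have count: "(\<Sum>a<b. residue_adj t k a b)
    = (2 * real b + t - real (q k (b mod t)) - real (q (t - k) (b mod t))) / t" for b
  proof -
    let ?r = "b mod t"
    have qk: "(b + j) mod t = q j ?r" for j by (simp add: q_def mod_add_left_eq)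
    have "real (q k ?r) = real ?r + real k - t * of_bool (q k ?r < ?r)"
    proof (cases "?r + k < t")
      case True
      then show ?thesis by (simp add: q_def)
    next
      case False
      then have "t \<le> ?r + k" "?r + k - t < t" using assms(5) mod_less_divisor[OF t, of b] by linarith+
      then have "q k ?r = ?r + k - t" by (simp add: q_def le_mod_geq)
      then show ?thesis using False assms(5) by (simp add: of_nat_diff)
    qed
    moreover have "real (q (t - k) ?r) = real ?r + (t - real k) - t * of_bool (q (t - k) ?r < ?r)"
    proof (cases "?r < k")
      case True
      then show ?thesis using assms(5) by (simp add: q_def of_nat_diff)
    next
      case False
      then have "t \<le> ?r + (t - k)" "?r + (t - k) - t < t" "?r + (t - k) - t = ?r - k"
        using assms(4,5) mod_less_divisor[OF t, of b] by linarith+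
      then have "q (t - k) ?r = ?r - k" by (simp add: q_def le_mod_geq)
      then show ?thesis using False assms(4,5) by (simp add: of_nat_diff)
    qed
    moreover have "(\<Sum>a<b. residue_adj t k a b)
      = 2 * (real b - real ?r) / t + of_bool (q k ?r < ?r) + of_bool (q (t - k) ?r < ?r)"
    proof -
      have "q j ?r < t" for j using t by (simp add: q_def)
      then show ?thesis unfolding residue_adj_def sum.distrib qk using sum_of_bool_residue[OF t]
        by (simp add: add_divide_distrib)
    qed
    ultimately show ?thesis using t by (simp add: field_simps)
  qed
  have adj: "(\<Sum>a\<in>X. residue_adj t k a b) = m (q k (b mod t)) + m (q (t - k) (b mod t))" for b
    using sum_residue_adj[OF assms(1), of t k b "\<lambda>_. 1"]
    by (simp add: m_def q_def mod_add_left_eq)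
  have "hook_count t k X = (\<Sum>b\<in>X. \<Sum>a<b. residue_adj t k a b)
      - (\<Sum>b\<in>X. \<Sum>a\<in>X. residue_adj t k a b) / 2"
    unfolding hook_count_def using assms
    by (intro sum_inversions residue_adj_commute residue_adj_self) auto
  also have "(\<Sum>b\<in>X. \<Sum>a\<in>X. residue_adj t k a b) = B k + B (t - k)"
    unfolding adj B_def sum.distrib
    using by_res[of "\<lambda>r. m (q k r)"] by_res[of "\<lambda>r. m (q (t - k) r)"] by simp
  also have "(\<Sum>b\<in>X. \<Sum>a<b. residue_adj t k a b)
      = (2 * (\<Sum>x\<in>X. real x) + t * N - A k - A (t - k)) / t"
  proof -
    have "real (card X) = N" using by_res[of "\<lambda>_. 1"] by (simp add: N_def)
    then have "(\<Sum>b\<in>X. 2 * real b + t - real (q k (b mod t)) - real (q (t - k) (b mod t)))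
        = 2 * (\<Sum>x\<in>X. real x) + t * N - A k - A (t - k)"
      unfolding A_def sum_subtractf sum.distrib
      using by_res[of "\<lambda>r. real (q k r)"] by_res[of "\<lambda>r. real (q (t - k) r)"]
      by (simp add: sum_distrib_left)
    then show ?thesis unfolding count by (simp only: sum_divide_distrib[symmetric])
  qed
  finally have "4 * t * hook_count t k X = 8 * (\<Sum>x\<in>X. real x) + 4 * t * N - 4 * A k - 4 * A (t - k)
      - 2 * t * (B k + B (t - k))"
    using t by (simp add: field_simps)
  moreover have "expected_gain t k X = 6 * (\<Sum>x\<in>X. real x) + charge_gain t k m + charge_gain t (t - k) m"
    unfolding m_def by (rule expected_gain_eq[OF assms(1,2) kt t])
  ultimately show ?thesis using charge[OF kt] charge[of "t - k"] kt
    by (simp add: of_nat_diff algebra_simps)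
qed

section \<open>Beads of a partition\<close>

text \<open>If \<open>M\<close> is at least the number of rows, nothing is cut off on the left. A
  margin of \<open>t\<close> more fills the positions below \<open>t\<close>, as the averages
  require, and lets the same \<open>M\<close> serve after a hook is added.\<close>

definition bead_set :: "nat \<Rightarrow> (nat \<times> nat) set \<Rightarrow> nat set" where
  "bead_set M \<rho> = {x. zero_one_seq \<rho> (int x - int M) = 0}"

lemma zero_one_seq_cases: "zero_one_seq \<rho> m = 0 \<or> zero_one_seq \<rho> m = 1"
  by (simp add: zero_one_seq_def)

lemma less_row_length_iff:
  assumes "young_diagram \<rho>"
  shows "j < row_length \<rho> i \<longleftrightarrow> i < col_length \<rho> j"
  using young_diagram_row[OF assms] young_diagram_col[OF assms] by blast

lemma row_length_antimono:
  assumes "young_diagram \<rho>" "i \<le> i'"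
  shows "row_length \<rho> i' \<le> row_length \<rho> i"
  using assms less_row_length_iff by (metis le_less_trans less_irrefl not_le)

lemma col_length_antimono:
  assumes "young_diagram \<rho>" "j \<le> j'"
  shows "col_length \<rho> j' \<le> col_length \<rho> j"
  using assms less_row_length_iff by (metis le_less_trans less_irrefl not_le)

lemma row_length_eq_0:
  assumes "young_diagram \<rho>" "col_length \<rho> 0 \<le> i"
  shows "row_length \<rho> i = 0"
  using less_row_length_iff[OF assms(1), of 0 i] assms(2) by simp

lemma zero_one_seq_below:
  assumes "young_diagram \<rho>" "m < - int (col_length \<rho> 0)"
  shows "zero_one_seq \<rho> m = 0"
proof -
  have "row_length \<rho> (nat (- m - 1)) = 0" using assms by (intro row_length_eq_0) auto
  moreover have "int (nat (- m - 1)) = - m - 1" using assms(2) by simp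
  ultimately have "m = int (row_length \<rho> (nat (- m - 1))) - int (nat (- m - 1)) - 1" by simp
  then have "\<exists>i. m = int (row_length \<rho> i) - int i - 1" by blast
  then show ?thesis by (simp add: zero_one_seq_def)
qed

text \<open>These are the beta-numbers of the partition; \<open>i < M\<close> makes the truncated
  subtraction exact.\<close>

lemma bead_set_eq:
  assumes "young_diagram \<rho>" "col_length \<rho> 0 \<le> M"
  shows "bead_set M \<rho> = (\<lambda>i. row_length \<rho> i + (M - 1 - i)) ` {..<M}"
proof
  show "bead_set M \<rho> \<subseteq> (\<lambda>i. row_length \<rho> i + (M - 1 - i)) ` {..<M}"
  proof
    fix x assume "x \<in> bead_set M \<rho>"
    then obtain i where i: "int x - int M = int (row_length \<rho> i) - int i - 1"
      by (auto simp: bead_set_def zero_one_seq_def split: if_splits)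
    have "i < M"
    proof (rule ccontr)
      assume "\<not> i < M"
      then have "row_length \<rho> i = 0" using assms by (intro row_length_eq_0) auto
      then show False using i \<open>\<not> i < M\<close> by linarith
    qed
    moreover from this have "x = row_length \<rho> i + (M - 1 - i)" using i by linarith
    ultimately show "x \<in> (\<lambda>i. row_length \<rho> i + (M - 1 - i)) ` {..<M}" by blast
  qed
next
  show "(\<lambda>i. row_length \<rho> i + (M - 1 - i)) ` {..<M} \<subseteq> bead_set M \<rho>"
  proof
    fix x assume "x \<in> (\<lambda>i. row_length \<rho> i + (M - 1 - i)) ` {..<M}"
    then obtain i where "i < M" "x = row_length \<rho> i + (M - 1 - i)" by auto
    then have "int x - int M = int (row_length \<rho> i) - int i - 1" by linarith
    then show "x \<in> bead_set M \<rho>" by (auto simp: bead_set_def zero_one_seq_def)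
  qed
qed

lemma
  assumes "young_diagram \<rho>" "col_length \<rho> 0 \<le> M"
  shows finite_bead_set: "finite (bead_set M \<rho>)"
    and card_bead_set: "card (bead_set M \<rho>) = M"
proof -
  have "inj_on (\<lambda>i. row_length \<rho> i + (M - 1 - i)) {..<M}"
  proof (rule linorder_inj_onI)
    fix i i' assume "i < i'" "i \<in> {..<M}" "i' \<in> {..<M}"
    then show "row_length \<rho> i + (M - 1 - i) \<noteq> row_length \<rho> i' + (M - 1 - i')"
      using row_length_antimono[OF assms(1), of i i'] by auto
  qed auto
  then show "finite (bead_set M \<rho>)" "card (bead_set M \<rho>) = M"
    unfolding bead_set_eq[OF assms] using card_image by fastforce+
qed

lemma lessThan_subset_bead_set:
  assumes "young_diagram \<rho>" "col_length \<rho> 0 + d \<le> M"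
  shows "{..<d} \<subseteq> bead_set M \<rho>"
  using assms zero_one_seq_below[OF assms(1)] by (auto simp: bead_set_def)

section \<open>Boxes as inversions\<close>

lemma hook_length_eq:
  assumes "young_diagram \<rho>" "(i, j) \<in> \<rho>"
  shows "int (hook_length \<rho> (i, j)) = int (row_length \<rho> i) - int j + int (col_length \<rho> j) - int i - 1"
proof -
  have "{j'. j < j' \<and> (i, j') \<in> \<rho>} = {j<..<row_length \<rho> i}"
    using young_diagram_row[OF assms(1)] by auto
  moreover have "{i'. i < i' \<and> (i', j) \<in> \<rho>} = {i<..<col_length \<rho> j}"
    using young_diagram_col[OF assms(1)] by auto
  ultimately have "hook_length \<rho> (i, j) = (row_length \<rho> i - Suc j) + (col_length \<rho> j - Suc i) + 1"
    by simp
  moreover have "j < row_length \<rho> i" "i < col_length \<rho> j"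
    using assms young_diagram_row[OF assms(1)] young_diagram_col[OF assms(1)] by blast+
  ultimately show ?thesis by linarith
qed

text \<open>A box corresponds to the horizontal and the vertical boundary edge in which its hook ends.\<close>

definition box_inversion :: "nat \<Rightarrow> (nat \<times> nat) set \<Rightarrow> nat \<times> nat \<Rightarrow> nat \<times> nat" where
  "box_inversion M \<rho> = (\<lambda>(i, j). (j + M - col_length \<rho> j, row_length \<rho> i + M - 1 - i))"

lemma
  assumes "young_diagram \<rho>" "col_length \<rho> 0 \<le> M"
  shows bij_betw_box_inversion: "bij_betw (box_inversion M \<rho>) \<rho> (inversions (bead_set M \<rho>))"
    and hook_length_box_inversion:
      "b \<in> \<rho> \<Longrightarrow> hook_length \<rho> b = snd (box_inversion M \<rho> b) - fst (box_inversion M \<rho> b)"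
proof -
  note Y = assms(1)
  have colM: "col_length \<rho> j \<le> M" for j using col_length_antimono[OF Y, of 0 j] assms(2) by simp
  have iM: "i < M" "j < row_length \<rho> i" "i < col_length \<rho> j" if "(i, j) \<in> \<rho>" for i j
    using that young_diagram_row[OF Y] young_diagram_col[OF Y] colM[of j] by (auto intro: less_le_trans)
  have fst_eq: "int (j + M - col_length \<rho> j) = int j + int M - int (col_length \<rho> j)" for j
    using colM[of j] by linarith
  have snd_eq: "int (row_length \<rho> i + M - 1 - i) = int (row_length \<rho> i) + int M - 1 - int i" if "i < M" for i
    using that by linarith
  have hook: "int (hook_length \<rho> (i, j)) = int (row_length \<rho> i + M - 1 - i) - int (j + M - col_length \<rho> j)"
    if "(i, j) \<in> \<rho>" for i j
    using hook_length_eq[OF Y that] fst_eq[of j] snd_eq[OF iM(1)[OF that]] by linarith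
  then show "b \<in> \<rho> \<Longrightarrow> hook_length \<rho> b = snd (box_inversion M \<rho> b) - fst (box_inversion M \<rho> b)"
    unfolding box_inversion_def by (cases b) force
  show "bij_betw (box_inversion M \<rho>) \<rho> (inversions (bead_set M \<rho>))"
  proof (rule bij_betw_imageI)
    show "inj_on (box_inversion M \<rho>) \<rho>"
    proof (rule inj_onI)
      fix b b' assume *: "b \<in> \<rho>" "b' \<in> \<rho>" "box_inversion M \<rho> b = box_inversion M \<rho> b'"
      obtain i j i' j' where b: "b = (i, j)" "b' = (i', j')" by (cases b, cases b') auto
      have 1: "int j - int (col_length \<rho> j) = int j' - int (col_length \<rho> j')"
        using *(3) fst_eq[of j] fst_eq[of j'] unfolding b box_inversion_def by simp
      have 2: "int (row_length \<rho> i) - int i = int (row_length \<rho> i') - int i'"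
        using *(3) snd_eq[of i] snd_eq[of i'] iM(1) * unfolding b box_inversion_def by force
      \<comment> \<open>The indices of column ends strictly increase with \<open>j\<close> and those
        of row ends strictly decrease with \<open>i\<close>, so equal ends force equal
        boxes.\<close>
      have "j = j'" using 1 col_length_antimono[OF Y, of j j'] col_length_antimono[OF Y, of j' j] by linarith
      moreover have "i = i'" using 2 row_length_antimono[OF Y, of i i'] row_length_antimono[OF Y, of i' i] by linarith
      ultimately show "b = b'" by (simp add: b)
    qed
    show "box_inversion M \<rho> ` \<rho> = inversions (bead_set M \<rho>)"
    proof (intro equalityI subsetI)
      fix p assume "p \<in> box_inversion M \<rho> ` \<rho>"
      then obtain i j where ij: "(i, j) \<in> \<rho>" "p = (j + M - col_length \<rho> j, row_length \<rho> i + M - 1 - i)"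
        by (auto simp: box_inversion_def)
      have "hook_length \<rho> (i, j) > 0" by simp
      then have "j + M - col_length \<rho> j < row_length \<rho> i + M - 1 - i" using hook[OF ij(1)] by linarith
      moreover have "int (j + M - col_length \<rho> j) - int M = int j - int (col_length \<rho> j)"
        using fst_eq[of j] by linarith
      then have "zero_one_seq \<rho> (int (j + M - col_length \<rho> j) - int M) = 1"
        using zero_one_seq_eq_1_iff[OF Y] by blast
      moreover have "int (row_length \<rho> i + M - 1 - i) - int M = int (row_length \<rho> i) - int i - 1"
        using snd_eq[OF iM(1)[OF ij(1)]] by linarith
      then have "zero_one_seq \<rho> (int (row_length \<rho> i + M - 1 - i) - int M) = 0"
        unfolding zero_one_seq_def by auto
      ultimately show "p \<in> inversions (bead_set M \<rho>)"
        unfolding ij(2) inversions_def bead_set_def by simp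
    next
      fix p assume "p \<in> inversions (bead_set M \<rho>)"
      then obtain a b where p: "p = (a, b)" "a < b" "a \<notin> bead_set M \<rho>" "b \<in> bead_set M \<rho>"
        by (auto simp: inversions_def)
      have "zero_one_seq \<rho> (int a - int M) = 1"
        using p(3) zero_one_seq_cases[of \<rho> "int a - int M"] by (simp add: bead_set_def)
      then obtain j where j: "int a - int M = int j - int (col_length \<rho> j)"
        using zero_one_seq_eq_1_iff[OF Y] by blast
      obtain i where i: "i < M" "b = row_length \<rho> i + (M - 1 - i)"
        using p(4) unfolding bead_set_eq[OF assms] by auto
      \<comment> \<open>For a box outside the diagram the row end precedes the column end on the
        boundary, contrary to \<open>a < b\<close>.\<close>
      have "(i, j) \<in> \<rho>"
      proof (rule ccontr)
        assume "(i, j) \<notin> \<rho>"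
        then have "row_length \<rho> i \<le> j" "col_length \<rho> j \<le> i"
          unfolding not_less[symmetric] using young_diagram_row[OF Y] young_diagram_col[OF Y] by blast+
        then show False using i j p(2) by linarith
      qed
      moreover have "p = box_inversion M \<rho> (i, j)"
        using i j fst_eq[of j] unfolding p(1) box_inversion_def by simp
      ultimately show "p \<in> box_inversion M \<rho> ` \<rho>" by blast
    qed
  qed
qed

text \<open>One statement transports the sums of squares, the counts and the product in
  \<open>G_fun\<close>.\<close>

lemma (in comm_monoid_set) hook_lengths_eq_inversions:
  assumes "young_diagram \<rho>" "col_length \<rho> 0 \<le> M"
  shows "F (\<lambda>b. g (hook_length \<rho> b)) \<rho> = F (\<lambda>(a, b). g (b - a)) (inversions (bead_set M \<rho>))"
proof -
  have "F (\<lambda>(a, b). g (b - a)) (inversions (bead_set M \<rho>))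
    = F (\<lambda>b. (\<lambda>(a, b). g (b - a)) (box_inversion M \<rho> b)) \<rho>"
    by (rule reindex_bij_betw[symmetric, OF bij_betw_box_inversion[OF assms]])
  also have "\<dots> = F (\<lambda>b. g (hook_length \<rho> b)) \<rho>"
    by (rule cong) (auto simp: hook_length_box_inversion[OF assms] split_def)
  finally show ?thesis ..
qed

lemma young_diagram_finite: "young_diagram \<rho> \<Longrightarrow> finite \<rho>"
  by (simp add: young_diagram_def)

lemma card_eq_card_inversions:
  assumes "young_diagram \<rho>" "col_length \<rho> 0 \<le> M"
  shows "card \<rho> = card (inversions (bead_set M \<rho>))"
  using bij_betw_same_card[OF bij_betw_box_inversion[OF assms]] .

lemma G_fun_eq:
  assumes "young_diagram \<rho>" "col_length \<rho> 0 \<le> M"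
  shows "G_fun t \<rho> = 1 / hook_prod t (bead_set M \<rho>)"
proof -
  have *: "(\<Prod>h\<in>#filter_mset P N. h) = (\<Prod>h\<in>#N. if P h then h else (1::nat))" for P N
    by (induction N) auto
  have "(\<Prod>h\<in>#filter_mset ((dvd) t) (hook_lengths \<rho>). h)
    = (\<Prod>b\<in>\<rho>. if t dvd hook_length \<rho> b then hook_length \<rho> b else 1)"
    unfolding * hook_lengths_def prod_unfold_prod_mset by (simp add: image_mset.compositionality comp_def)
  also have "\<dots> = hook_prod t (bead_set M \<rho>)"
    unfolding hook_prod_def
    by (rule prod.hook_lengths_eq_inversions[OF assms, of "\<lambda>h. if t dvd h then h else 1"])
  finally show ?thesis by (simp add: G_fun_def)
qed

definition hook_squares :: "nat \<Rightarrow> nat \<Rightarrow> (nat \<times> nat) set \<Rightarrow> real" where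
  "hook_squares t k \<rho> = (\<Sum>b | b \<in> \<rho> \<and> [hook_length \<rho> b = k] (mod t). (real (hook_length \<rho> b))\<^sup>2)
    + (\<Sum>b | b \<in> \<rho> \<and> [hook_length \<rho> b = t - k] (mod t). (real (hook_length \<rho> b))\<^sup>2)"

lemma hook_squares_eq:
  assumes "young_diagram \<rho>" "col_length \<rho> 0 \<le> M" "k \<le> t"
  shows "hook_squares t k \<rho> = hook_square_sum t k (bead_set M \<rho>)"
proof -
  let ?g = "\<lambda>h :: nat. (of_bool ([h = k] (mod t)) + of_bool ([h = t - k] (mod t))) * (real h)\<^sup>2"
  have *: "(\<Sum>b | b \<in> \<rho> \<and> P b. h b) = (\<Sum>b\<in>\<rho>. of_bool (P b) * h b)" for P and h :: "nat \<times> nat \<Rightarrow> real"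
    using sum.inter_filter[OF young_diagram_finite[OF assms(1)], of h P]
    by (auto intro!: sum.cong)
  have "hook_squares t k \<rho> = (\<Sum>b\<in>\<rho>. ?g (hook_length \<rho> b))"
    unfolding hook_squares_def * by (simp only: distrib_right sum.distrib)
  also have "\<dots> = (\<Sum>(a, b)\<in>inversions (bead_set M \<rho>). ?g (b - a))"
    by (rule sum.hook_lengths_eq_inversions[OF assms(1,2)])
  also have "\<dots> = hook_square_sum t k (bead_set M \<rho>)"
    unfolding hook_square_sum_def using assms(3)
    by (intro sum.cong) (auto simp: inversions_def residue_adj_eq of_nat_diff)
  finally show ?thesis .
qed

lemma hook_count_eq:
  assumes "young_diagram \<rho>" "col_length \<rho> 0 \<le> M" "k \<le> t"
  shows "real (size (hook_lengths_mod t \<rho> k)) + real (size (hook_lengths_mod t \<rho> (t - k)))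
    = hook_count t k (bead_set M \<rho>)"
proof -
  let ?g = "\<lambda>h :: nat. of_bool ([h = k] (mod t)) + of_bool ([h = t - k] (mod t)) :: real"
  have *: "real (size (filter_mset P N)) = (\<Sum>h\<in>#N. of_bool (P h))" for P and N :: "nat multiset"
    by (induction N) auto
  have "real (size (hook_lengths_mod t \<rho> j)) = (\<Sum>b\<in>\<rho>. of_bool ([hook_length \<rho> b = j] (mod t)))" for j
    unfolding hook_lengths_mod_def * hook_lengths_def sum_unfold_sum_mset
    by (simp only: image_mset.compositionality comp_def)
  then have "real (size (hook_lengths_mod t \<rho> k)) + real (size (hook_lengths_mod t \<rho> (t - k)))
    = (\<Sum>b\<in>\<rho>. ?g (hook_length \<rho> b))"
    by (simp only: sum.distrib)
  also have "\<dots> = (\<Sum>(a, b)\<in>inversions (bead_set M \<rho>). ?g (b - a))"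
    by (rule sum.hook_lengths_eq_inversions[OF assms(1,2)])
  also have "\<dots> = hook_count t k (bead_set M \<rho>)"
    unfolding hook_count_def using assms(3)
    by (intro sum.cong) (auto simp: inversions_def residue_adj_eq)
  finally show ?thesis .
qed

section \<open>Recovering a partition from its beads\<close>

text \<open>Positions of label 0 strictly decrease with the row index, so rows are recovered from
  the top: once the rows above agree, the position of row \<open>i\<close> of one diagram can only
  occur at a row \<open>j \<ge> i\<close> of the other.\<close>

lemma zero_one_seq_inject:
  assumes "young_diagram \<rho>" "young_diagram \<sigma>" "zero_one_seq \<rho> = zero_one_seq \<sigma>"
  shows "\<rho> = \<sigma>"
proof -
  have row_in: "\<exists>j. int (row_length \<alpha> i) - int i = int (row_length \<beta> j) - int j"
    if "zero_one_seq \<alpha> = zero_one_seq \<beta>" for \<alpha> \<beta> i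
  proof -
    have "zero_one_seq \<beta> (int (row_length \<alpha> i) - int i - 1) = 0"
      unfolding that[symmetric] zero_one_seq_def by auto
    then show ?thesis by (auto simp: zero_one_seq_def split: if_splits)
  qed
  have le: "row_length \<beta> i \<le> row_length \<alpha> i"
    if "young_diagram \<alpha>" "young_diagram \<beta>" "zero_one_seq \<alpha> = zero_one_seq \<beta>"
      "\<And>i'. i' < i \<Longrightarrow> row_length \<alpha> i' = row_length \<beta> i'" for \<alpha> \<beta> i
  proof (rule ccontr)
    assume less: "\<not> row_length \<beta> i \<le> row_length \<alpha> i"
    from row_in[OF that(3)[symmetric], of i]
    obtain j where j: "int (row_length \<beta> i) - int i = int (row_length \<alpha> j) - int j"
      by blast
    show False
    proof (cases "j < i")
      case True
      then show False using j that(4)[of j] row_length_antimono[OF that(2), of j i] by simp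
    next
      case False
      then show False using j less row_length_antimono[OF that(1), of i j] by simp
    qed
  qed
  have "row_length \<rho> i = row_length \<sigma> i" for i
  proof (induction i rule: less_induct)
    case (less i)
    then show ?case
      using le[OF assms(1,2,3), of i] le[OF assms(2,1) assms(3)[symmetric], of i] by fastforce
  qed
  then show ?thesis
    using young_diagram_row[OF assms(1)] young_diagram_row[OF assms(2)] by auto
qed

lemma bead_set_inject:
  assumes "young_diagram \<rho>" "young_diagram \<sigma>" "col_length \<rho> 0 \<le> M" "col_length \<sigma> 0 \<le> M"
    and "bead_set M \<rho> = bead_set M \<sigma>"
  shows "\<rho> = \<sigma>"
proof (rule zero_one_seq_inject[OF assms(1,2)], rule ext)
  fix m
  show "zero_one_seq \<rho> m = zero_one_seq \<sigma> m"
  proof (cases "m < - int M")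
    case True
    then show ?thesis using assms zero_one_seq_below by simp
  next
    case False
    then have "m = int (nat (m + int M)) - int M" by simp
    moreover have "nat (m + int M) \<in> bead_set M \<rho> \<longleftrightarrow> nat (m + int M) \<in> bead_set M \<sigma>"
      using assms(5) by simp
    ultimately show ?thesis
      using zero_one_seq_cases[of \<rho> m] zero_one_seq_cases[of \<sigma> m] by (auto simp: bead_set_def)
  qed
qed

text \<open>The beads in decreasing order give the rows from the top; the length of a row is the
  number of gaps to the left of its bead.\<close>

lemma bead_set_surj:
  assumes "finite X" "card X = M"
  obtains \<rho> where "young_diagram \<rho>" "col_length \<rho> 0 \<le> M" "bead_set M \<rho> = X"
proof -
  define ys where "ys = sorted_list_of_set X"
  have ys: "length ys = M" "set ys = X" "sorted_wrt (<) ys"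
    using assms by (simp_all add: ys_def strict_sorted_list_of_set)
  \<comment> \<open>Strictly increasing naturals grow by at least 1 per index; this makes the
    subtraction in \<open>r\<close> exact and \<open>r\<close> antitone.\<close>
  have ys_gap: "ys ! m + (m' - m) \<le> ys ! m'" if "m \<le> m'" "m' < M" for m m'
    using that
  proof (induction "m' - m" arbitrary: m')
    case (Suc d)
    then obtain l where l: "m' = Suc l" by (cases m') auto
    have "ys ! l < ys ! m'" using sorted_wrt_nth_less[OF ys(3), of l m'] Suc.prems ys(1) l by simp
    moreover have "d = l - m" "m \<le> l" "l < M" using Suc.hyps(2) Suc.prems l by linarith+
    from Suc.hyps(1)[OF this] have "ys ! m + (l - m) \<le> ys ! l" .
    ultimately show ?case using l \<open>m \<le> l\<close> by linarith
  qed simp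
  define r where "r i = (if i < M then ys ! (M - 1 - i) - (M - 1 - i) else 0)" for i
  have r_anti: "r i' \<le> r i" if "i \<le> i'" for i i'
  proof (cases "i' < M")
    case True
    then have "M - 1 - i' \<le> M - 1 - i" "M - 1 - i < M" using that by linarith+
    from ys_gap[OF this] show ?thesis using True that by (simp add: r_def)
  qed (simp add: r_def)
  define \<rho> where "\<rho> = {(i, j). j < r i}"
  have "\<rho> \<subseteq> {..<M} \<times> {..<r 0}"
    using r_anti[of 0] by (auto simp: \<rho>_def r_def[of i for i] intro: less_le_trans split: if_splits)
  then have Y: "young_diagram \<rho>"
    unfolding young_diagram_def using r_anti
    by (auto intro: finite_subset simp: \<rho>_def intro: le_less_trans less_le_trans)
  have row: "row_length \<rho> i = r i" for i by (simp add: row_length_def \<rho>_def)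
  have col: "col_length \<rho> 0 \<le> M"
  proof (rule ccontr)
    assume "\<not> col_length \<rho> 0 \<le> M"
    then have "0 < row_length \<rho> M" using less_row_length_iff[OF Y, of 0 M] by simp
    then show False by (simp add: row r_def)
  qed
  have "bead_set M \<rho> = (\<lambda>i. ys ! (M - 1 - i)) ` {..<M}"
    unfolding bead_set_eq[OF Y col]
  proof (rule image_cong)
    fix i assume "i \<in> {..<M}"
    then show "row_length \<rho> i + (M - 1 - i) = ys ! (M - 1 - i)"
      using ys_gap[of 0 "M - 1 - i"] by (simp add: row r_def)
  qed simp
  also have "\<dots> = (!) ys ` ((\<lambda>i. M - 1 - i) ` {..<M})" by (simp add: image_image)
  also have "(\<lambda>i. M - 1 - i) ` {..<M} = {..<M}"
  proof (intro equalityI subsetI)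
    fix i assume "i \<in> {..<M}"
    then show "i \<in> (\<lambda>i. M - 1 - i) ` {..<M}" by (intro image_eqI[of _ _ "M - 1 - i"]) auto
  qed auto
  also have "(!) ys ` {..<M} = X" using ys by (auto simp: set_conv_nth)
  finally show ?thesis using that Y col by blast
qed

section \<open>Adding hooks as moving beads\<close>

text \<open>All labels left of \<open>- col_length \<nu> 0\<close> are 0 and position
  \<open>i + t\<close> carries a 1, so the margin \<open>t\<close> keeps the source \<open>i\<close>
  of the move within the window that starts at \<open>- M\<close>.\<close>

lemma adds_t_hook_bead_set:
  assumes "adds_t_hook t \<nu> \<rho>" "t > 0" "col_length \<nu> 0 + t \<le> M"
  shows "col_length \<rho> 0 \<le> M"
    and "\<exists>b\<in>bead_set M \<nu>. b + t \<notin> bead_set M \<nu> \<and> bead_set M \<rho> = move_bead t (bead_set M \<nu>) b"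
proof -
  have Y: "young_diagram \<nu>" "young_diagram \<rho>" using assms(1) by (auto simp: adds_t_hook_def)
  obtain i where i: "zero_one_seq \<nu> i = 0" "zero_one_seq \<nu> (i + int t) = 1"
    "zero_one_seq \<rho> = (zero_one_seq \<nu>)(i := 1, i + int t := 0)"
    using assms(1) by (auto simp: adds_t_hook_def)
  have iM: "i \<ge> - int M" using zero_one_seq_below[OF Y(1), of "i + int t"] i(2) assms(3) by force
  show "col_length \<rho> 0 \<le> M"
  proof (rule ccontr)
    assume c: "\<not> col_length \<rho> 0 \<le> M"
    \<comment> \<open>The first horizontal edge of \<open>\<rho>\<close> would lie left of
      \<open>- M\<close>, where \<open>\<nu>\<close> has only 0s and the move creates no 1.\<close>
    have "zero_one_seq \<rho> (- int (col_length \<rho> 0)) = 1"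
      unfolding zero_one_seq_eq_1_iff[OF Y(2)] by (intro exI[of _ 0]) simp
    moreover have "zero_one_seq \<nu> (- int (col_length \<rho> 0)) = 0"
      using zero_one_seq_below[OF Y(1)] c assms(3) by simp
    ultimately show False using i(3) iM c by (auto split: if_splits)
  qed
  define b where "b = nat (i + int M)"
  have b: "i = int b - int M" using iM by (simp add: b_def)
  have "b \<in> bead_set M \<nu>" "b + t \<notin> bead_set M \<nu>"
    using i(1,2) unfolding b bead_set_def by (simp_all add: algebra_simps)
  moreover have "bead_set M \<rho> = move_bead t (bead_set M \<nu>) b"
    unfolding bead_set_def move_bead_def i(3) b using assms(2) by auto
  ultimately show "\<exists>b\<in>bead_set M \<nu>. b + t \<notin> bead_set M \<nu> \<and> bead_set M \<rho> = move_bead t (bead_set M \<nu>) b"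
    by blast
qed

lemma adds_t_hookI:
  assumes "young_diagram \<nu>" "young_diagram \<rho>" "col_length \<nu> 0 \<le> M" "col_length \<rho> 0 \<le> M"
    and "b \<in> bead_set M \<nu>" "b + t \<notin> bead_set M \<nu>" "bead_set M \<rho> = move_bead t (bead_set M \<nu>) b"
  shows "adds_t_hook t \<nu> \<rho>"
proof -
  let ?i = "int b - int M"
  have i: "zero_one_seq \<nu> ?i = 0" "zero_one_seq \<nu> (?i + int t) = 1"
    using assms(5,6) zero_one_seq_cases[of \<nu> "?i + int t"]
    by (simp_all add: bead_set_def algebra_simps)
  have "zero_one_seq \<rho> m = ((zero_one_seq \<nu>)(?i := 1, ?i + int t := 0)) m" for m
  proof (cases "m < - int M")
    case True
    then show ?thesis using assms zero_one_seq_below by simp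
  next
    case False
    define x where "x = nat (m + int M)"
    have x: "m = int x - int M" using False by (simp add: x_def)
    have "zero_one_seq \<rho> m = 0 \<longleftrightarrow> x = b + t \<or> zero_one_seq \<nu> m = 0 \<and> x \<noteq> b"
      using assms(7) unfolding x bead_set_def move_bead_def by auto
    then show ?thesis
      using zero_one_seq_cases[of \<rho> m] zero_one_seq_cases[of \<nu> m] unfolding x by (auto split: if_splits)
  qed
  then show ?thesis using assms(1,2) i unfolding adds_t_hook_def by blast
qed

lemma card_adds_t_hook:
  assumes "adds_t_hook t \<nu> \<rho>" "t > 0"
  shows "card \<rho> = card \<nu> + t"
proof -
  define M where "M = col_length \<nu> 0 + t"
  have Y: "young_diagram \<nu>" "young_diagram \<rho>" using assms(1) by (auto simp: adds_t_hook_def)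
  note * = adds_t_hook_bead_set[OF assms, of M]
  have M: "col_length \<nu> 0 \<le> M" "col_length \<rho> 0 \<le> M" using *(1) by (simp_all add: M_def)
  show ?thesis
    using *(2) card_inversions_move_bead[OF finite_bead_set[OF Y(1) M(1)]]
    unfolding card_eq_card_inversions[OF Y(1) M(1)] card_eq_card_inversions[OF Y(2) M(2)]
    by (auto simp: M_def)
qed

lemma adds_t_hook_young_diagram:
  "adds_t_hook t \<nu> \<rho> \<Longrightarrow> young_diagram \<nu> \<and> young_diagram \<rho>"
  by (simp add: adds_t_hook_def)

lemma card_insert_Diff_singleton:
  assumes "finite X" "y \<in> X" "x \<notin> X"
  shows "card (insert x (X - {y})) = card X"
proof -
  have "card (insert x (X - {y})) = Suc (card (X - {y}))"
    using assms by (intro card_insert_disjoint) auto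
  also have "\<dots> = card X" using assms(1,2) by (rule card_Suc_Diff1)
  finally show ?thesis .
qed

lemma bij_betw_adds_t_hook:
  assumes "young_diagram \<nu>" "t > 0" "col_length \<nu> 0 + t \<le> M"
  shows "bij_betw (bead_set M) {\<rho>. adds_t_hook t \<nu> \<rho>}
    (move_bead t (bead_set M \<nu>) ` {b \<in> bead_set M \<nu>. b + t \<notin> bead_set M \<nu>})"
proof (rule bij_betw_imageI)
  let ?X = "bead_set M \<nu>"
  have \<nu>M: "col_length \<nu> 0 \<le> M" using assms(3) by simp
  note up = adds_t_hook_bead_set[OF _ assms(2,3)]
  show "inj_on (bead_set M) {\<rho>. adds_t_hook t \<nu> \<rho>}"
  proof (rule inj_onI, elim CollectE)
    fix \<rho> \<sigma> assume *: "adds_t_hook t \<nu> \<rho>" "adds_t_hook t \<nu> \<sigma>" "bead_set M \<rho> = bead_set M \<sigma>"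
    show "\<rho> = \<sigma>"
      using adds_t_hook_young_diagram[OF *(1)] adds_t_hook_young_diagram[OF *(2)]
        bead_set_inject[OF _ _ up(1)[OF *(1)] up(1)[OF *(2)] *(3)] by blast
  qed
  show "bead_set M ` {\<rho>. adds_t_hook t \<nu> \<rho>} = move_bead t ?X ` {b \<in> ?X. b + t \<notin> ?X}"
  proof (intro equalityI subsetI)
    fix Z assume "Z \<in> move_bead t ?X ` {b \<in> ?X. b + t \<notin> ?X}"
    then obtain b where b: "b \<in> ?X" "b + t \<notin> ?X" "Z = move_bead t ?X b" by blast
    have "finite ?X" "card ?X = M" using finite_bead_set card_bead_set assms(1) \<nu>M by auto
    then have "finite Z" "card Z = M"
      using b card_insert_Diff_singleton[of ?X b "b + t"] by (simp_all add: move_bead_def)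
    then obtain \<rho> where \<rho>: "young_diagram \<rho>" "col_length \<rho> 0 \<le> M" "bead_set M \<rho> = Z"
      by (rule bead_set_surj)
    then have "adds_t_hook t \<nu> \<rho>" using adds_t_hookI[OF assms(1) \<rho>(1) \<nu>M \<rho>(2) b(1,2)] b(3) by simp
    then show "Z \<in> bead_set M ` {\<rho>. adds_t_hook t \<nu> \<rho>}" using \<rho>(3) by blast
  next
    fix Z assume "Z \<in> bead_set M ` {\<rho>. adds_t_hook t \<nu> \<rho>}"
    then show "Z \<in> move_bead t ?X ` {b \<in> ?X. b + t \<notin> ?X}" using up(2) by blast
  qed
qed

lemma inj_on_move_bead: "inj_on (move_bead t X) {b \<in> X. b + t \<notin> X}"
proof (rule inj_onI)
  fix b c assume *: "b \<in> {b \<in> X. b + t \<notin> X}" "c \<in> {b \<in> X. b + t \<notin> X}"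
    "move_bead t X b = move_bead t X c"
  then have "b + t \<in> move_bead t X c" "b + t \<notin> X" by (auto simp: move_bead_def)
  then show "b = c" by (auto simp: move_bead_def)
qed

lemma finite_adds_t_hook:
  assumes "young_diagram \<nu>" "t > 0"
  shows "finite {\<rho>. adds_t_hook t \<nu> \<rho>}"
proof -
  let ?X = "bead_set (col_length \<nu> 0 + t) \<nu>"
  have "finite ?X" by (rule finite_bead_set[OF assms(1)]) simp
  then have "finite (move_bead t ?X ` {b \<in> ?X. b + t \<notin> ?X})" by simp
  then show ?thesis using bij_betw_finite[OF bij_betw_adds_t_hook[OF assms order_refl]] by blast
qed

lemma G_fun_pos:
  assumes "young_diagram \<rho>"
  shows "G_fun t \<rho> > 0"
  unfolding G_fun_eq[OF assms order_refl] using hook_prod_pos[of t] by simp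

text \<open>Passes from diagrams to beads: \<open>hook_prod_move_bead\<close> turns quotients of
  \<open>G_fun\<close> into transition weights, and blocked beads join with weight 0.\<close>

lemma sum_adds_t_hook:
  assumes "young_diagram \<nu>" "t > 0" "col_length \<nu> 0 + t \<le> M"
  shows "(\<Sum>\<rho> | adds_t_hook t \<nu> \<rho>. G_fun t \<rho> * h (bead_set M \<rho>))
    = G_fun t \<nu> * (\<Sum>b\<in>bead_set M \<nu>. transition_weight t (bead_set M \<nu>) b * h (move_bead t (bead_set M \<nu>) b))"
proof -
  let ?X = "bead_set M \<nu>"
  let ?A = "{b \<in> ?X. b + t \<notin> ?X}"
  have \<nu>M: "col_length \<nu> 0 \<le> M" using assms(3) by simp
  note fin = finite_bead_set[OF assms(1) \<nu>M]
  have "(\<Sum>\<rho> | adds_t_hook t \<nu> \<rho>. G_fun t \<rho> * h (bead_set M \<rho>))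
    = (\<Sum>\<rho> | adds_t_hook t \<nu> \<rho>. 1 / hook_prod t (bead_set M \<rho>) * h (bead_set M \<rho>))"
  proof (intro sum.cong refl, elim CollectE)
    fix \<rho> assume a: "adds_t_hook t \<nu> \<rho>"
    show "G_fun t \<rho> * h (bead_set M \<rho>) = 1 / hook_prod t (bead_set M \<rho>) * h (bead_set M \<rho>)"
      using G_fun_eq[OF _ adds_t_hook_bead_set(1)[OF a assms(2,3)]] adds_t_hook_young_diagram[OF a] by simp
  qed
  also have "\<dots> = (\<Sum>Z\<in>move_bead t ?X ` ?A. 1 / hook_prod t Z * h Z)"
    by (rule sum.reindex_bij_betw[OF bij_betw_adds_t_hook[OF assms]])
  also have "\<dots> = (\<Sum>b\<in>?A. 1 / hook_prod t (move_bead t ?X b) * h (move_bead t ?X b))"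
    by (subst sum.reindex[OF inj_on_move_bead]) simp
  also have "\<dots> = (\<Sum>b\<in>?A. G_fun t \<nu> * (transition_weight t ?X b * h (move_bead t ?X b)))"
    using hook_prod_pos[of t ?X]
    by (intro sum.cong) (auto simp: G_fun_eq[OF assms(1) \<nu>M] hook_prod_move_bead[OF fin _ _ assms(2), symmetric])
  also have "\<dots> = (\<Sum>b\<in>?X. G_fun t \<nu> * (transition_weight t ?X b * h (move_bead t ?X b)))"
    using fin transition_weight_eq_0[OF fin _ assms(2)] by (intro sum.mono_neutral_left) auto
  finally show ?thesis by (simp only: sum_distrib_left)
qed

section \<open>The mean increment\<close>

text \<open>An average with weights \<open>G_fun t \<rho> / G_fun t \<nu>\<close>, which add up to 1
  by \<open>sum_G_fun_adds_t_hook\<close>. Unlike \<open>expected_gain\<close> it involves no choice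
  of \<open>M\<close>.\<close>

definition mean_gain :: "nat \<Rightarrow> nat \<Rightarrow> (nat \<times> nat) set \<Rightarrow> real" where
  "mean_gain t k \<nu> = (\<Sum>\<rho> | adds_t_hook t \<nu> \<rho>. G_fun t \<rho> * (hook_squares t k \<rho> - hook_squares t k \<nu>)) / G_fun t \<nu>"

lemma sum_G_fun_adds_t_hook:
  assumes "young_diagram \<nu>" "t > 0"
  shows "(\<Sum>\<rho> | adds_t_hook t \<nu> \<rho>. G_fun t \<rho>) = G_fun t \<nu>"
proof -
  let ?X = "bead_set (col_length \<nu> 0 + t) \<nu>"
  have "(\<Sum>b\<in>?X. transition_weight t ?X b) = 1"
    using assms finite_bead_set lessThan_subset_bead_set by (intro sum_transition_weight_eq_1) auto
  then show ?thesis using sum_adds_t_hook[OF assms order_refl, of "\<lambda>_. 1"] by simp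
qed

lemma sum_G_fun_hook_squares_adds_t_hook:
  assumes "young_diagram \<nu>" "t > 0"
  shows "(\<Sum>\<rho> | adds_t_hook t \<nu> \<rho>. G_fun t \<rho> * hook_squares t k \<rho>)
    = G_fun t \<nu> * (hook_squares t k \<nu> + mean_gain t k \<nu>)"
proof -
  have "G_fun t \<nu> * mean_gain t k \<nu> = (\<Sum>\<rho> | adds_t_hook t \<nu> \<rho>. G_fun t \<rho> * hook_squares t k \<rho>)
      - (\<Sum>\<rho> | adds_t_hook t \<nu> \<rho>. G_fun t \<rho>) * hook_squares t k \<nu>"
    using G_fun_pos[OF assms(1), of t]
    unfolding mean_gain_def right_diff_distrib sum_subtractf sum_distrib_right by simp
  then show ?thesis unfolding sum_G_fun_adds_t_hook[OF assms] by (simp add: distrib_left)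
qed

lemma mean_gain_eq:
  assumes "young_diagram \<nu>" "0 < k" "k < t" "col_length \<nu> 0 + t \<le> M"
  shows "mean_gain t k \<nu> = expected_gain t k (bead_set M \<nu>)"
proof -
  let ?X = "bead_set M \<nu>" and ?s = "hook_square_sum t k"
  have t: "t > 0" "k \<le> t" and \<nu>M: "col_length \<nu> 0 \<le> M" using assms by auto
  note fin = finite_bead_set[OF assms(1) \<nu>M]
  have "(\<Sum>\<rho> | adds_t_hook t \<nu> \<rho>. G_fun t \<rho> * (hook_squares t k \<rho> - hook_squares t k \<nu>))
    = (\<Sum>\<rho> | adds_t_hook t \<nu> \<rho>. G_fun t \<rho> * (?s (bead_set M \<rho>) - ?s ?X))"
  proof (intro sum.cong refl, elim CollectE)
    fix \<rho> assume a: "adds_t_hook t \<nu> \<rho>"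
    show "G_fun t \<rho> * (hook_squares t k \<rho> - hook_squares t k \<nu>)
      = G_fun t \<rho> * (?s (bead_set M \<rho>) - ?s ?X)"
      using hook_squares_eq[OF _ adds_t_hook_bead_set(1)[OF a t(1) assms(4)] t(2)]
        hook_squares_eq[OF assms(1) \<nu>M t(2)] adds_t_hook_young_diagram[OF a] by simp
  qed
  also have "\<dots> = G_fun t \<nu> * (\<Sum>b\<in>?X. transition_weight t ?X b * (?s (move_bead t ?X b) - ?s ?X))"
    by (rule sum_adds_t_hook[OF assms(1) t(1) assms(4)])
  also have "(\<Sum>b\<in>?X. transition_weight t ?X b * (?s (move_bead t ?X b) - ?s ?X)) = expected_gain t k ?X"
    unfolding expected_gain_def
  proof (rule sum.cong)
    fix b assume "b \<in> ?X"
    then show "transition_weight t ?X b * (?s (move_bead t ?X b) - ?s ?X)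
      = transition_weight t ?X b * (bead_gain t ?X k b + bead_gain t ?X (t - k) b)"
      using hook_square_sum_move_bead[OF fin, of b t k] transition_weight_eq_0[OF fin, of b t] assms t
      by (cases "b + t \<in> ?X") auto
  qed simp
  finally show ?thesis using G_fun_pos[OF assms(1), of t] by (simp add: mean_gain_def)
qed

lemma mean_gain_adds_t_hook:
  assumes "adds_t_hook t \<nu> \<rho>" "0 < k" "k < t"
  shows "mean_gain t k \<rho> = mean_gain t k \<nu> + 6 * t"
proof -
  \<comment> \<open>One shift fits both diagrams, each with margin \<open>t\<close>; moreover the
    positions below \<open>2 * t\<close> are filled, so a free \<open>b + t\<close> forces
    \<open>t \<le> b\<close>.\<close>
  define M where "M = col_length \<nu> 0 + 2 * t"
  have t: "t > 0" using assms by simp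
  have Y: "young_diagram \<nu>" "young_diagram \<rho>" using adds_t_hook_young_diagram[OF assms(1)] by auto
  have \<rho>M: "col_length \<rho> 0 + t \<le> M"
    using adds_t_hook_bead_set(1)[OF assms(1) t order_refl] by (simp add: M_def)
  obtain b where b: "b \<in> bead_set M \<nu>" "b + t \<notin> bead_set M \<nu>"
    "bead_set M \<rho> = move_bead t (bead_set M \<nu>) b"
    using adds_t_hook_bead_set(2)[OF assms(1) t, of M] by (auto simp: M_def)
  have "{..<2 * t} \<subseteq> bead_set M \<nu>" by (rule lessThan_subset_bead_set[OF Y(1)]) (simp add: M_def)
  then have "\<not> b + t < 2 * t" "{..<t} \<subseteq> bead_set M \<nu>"
    using b(2) by (blast, fastforce)
  then have "t \<le> b" "{..<t} \<subseteq> bead_set M \<nu>" by simp_all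
  moreover have "finite (bead_set M \<nu>)" by (rule finite_bead_set[OF Y(1)]) (simp add: M_def)
  ultimately show ?thesis
    using mean_gain_eq[OF Y(1) assms(2,3), of M] mean_gain_eq[OF Y(2) assms(2,3) \<rho>M]
      expected_gain_move_bead[of "bead_set M \<nu>" b t k] b assms by (simp add: M_def)
qed

section \<open>Cores and their mean increment\<close>

text \<open>A bead with a gap \<open>t\<close> places to its left forms an inversion, hence a box of
  hook length \<open>t\<close>.\<close>

lemma is_t_core_bead_set:
  assumes "is_t_core t \<mu>" "col_length \<mu> 0 \<le> M" "t > 0" "x \<in> bead_set M \<mu>" "t \<le> x"
  shows "x - t \<in> bead_set M \<mu>"
proof (rule ccontr)
  have Y: "young_diagram \<mu>" using assms(1) by (simp add: is_t_core_def)
  assume "x - t \<notin> bead_set M \<mu>"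
  then have "(x - t, x) \<in> inversions (bead_set M \<mu>)" using assms by (simp add: inversions_def)
  then have "(x - t, x) \<in> box_inversion M \<mu> ` \<mu>"
    using bij_betw_imp_surj_on[OF bij_betw_box_inversion[OF Y assms(2)]] by simp
  then obtain b where "b \<in> \<mu>" "box_inversion M \<mu> b = (x - t, x)" by force
  then have "hook_length \<mu> b = t" "b \<in> \<mu>"
    using hook_length_box_inversion[OF Y assms(2), of b] assms(5) by simp_all
  then show False
    using assms(1) young_diagram_finite[OF Y] by (force simp: is_t_core_def hook_lengths_def)
qed

lemma is_t_core_no_removable:
  assumes "is_t_core t \<mu>" "t > 0"
  shows "\<not> adds_t_hook t \<nu> \<mu>"
proof
  assume a: "adds_t_hook t \<nu> \<mu>"
  note * = adds_t_hook_bead_set[OF a assms(2) order_refl]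
  define M where "M = col_length \<nu> 0 + t"
  obtain b where "bead_set M \<mu> = move_bead t (bead_set M \<nu>) b"
    using *(2) by (auto simp: M_def)
  then have "b + t \<in> bead_set M \<mu>" "b \<notin> bead_set M \<mu>" using assms(2) by (auto simp: move_bead_def)
  then show False
    using is_t_core_bead_set[OF assms(1) _ assms(2), of M "b + t"] *(1) by (simp add: M_def)
qed

lemma G_fun_core:
  assumes "is_t_core t \<mu>"
  shows "G_fun t \<mu> = 1"
proof -
  have "filter_mset ((dvd) t) (hook_lengths \<mu>) = filter_mset (\<lambda>_. False) (hook_lengths \<mu>)"
    using assms by (intro filter_mset_cong) (auto simp: is_t_core_def)
  then have none: "filter_mset ((dvd) t) (hook_lengths \<mu>) = {#}" by (simp only: filter_mset_False)
  show ?thesis unfolding G_fun_def none by simp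
qed

lemma mean_gain_core:
  assumes "is_t_core t \<mu>" "0 < k" "k < t"
  shows "mean_gain t k \<mu> = 2 * real k * (real t - real k)
     + 4 * real t * real (size (hook_lengths_mod t \<mu> k))
     + 4 * real t * real (size (hook_lengths_mod t \<mu> (t - k)))"
proof -
  define M where "M = col_length \<mu> 0 + t"
  have Y: "young_diagram \<mu>" using assms(1) by (simp add: is_t_core_def)
  have t: "t > 0" "k \<le> t" and M: "col_length \<mu> 0 \<le> M" "col_length \<mu> 0 + t \<le> M" 
    using assms by (auto simp: M_def)
  have "mean_gain t k \<mu> = expected_gain t k (bead_set M \<mu>)"
    by (rule mean_gain_eq[OF Y assms(2,3) M(2)])
  also have "\<dots> = 4 * t * hook_count t k (bead_set M \<mu>) + 2 * real k * (real t - real k)"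
    using expected_gain_core[OF finite_bead_set[OF Y M(1)] lessThan_subset_bead_set[OF Y M(2)]
        is_t_core_bead_set[OF assms(1) M(1) t(1)] assms(2,3)] by simp
  finally show ?thesis unfolding hook_count_eq[OF Y M(1) t(2), symmetric]
    by (simp add: algebra_simps)
qed

section \<open>Uniqueness of the core\<close>

text \<open>Two different removals from \<open>\<rho>\<close> move different beads back; doing both
  gives the common diagram \<open>\<gamma>\<close>.\<close>

lemma adds_t_hook_diamond:
  assumes "adds_t_hook t \<alpha> \<rho>" "adds_t_hook t \<beta> \<rho>" "\<alpha> \<noteq> \<beta>" "t > 0"
  shows "\<exists>\<gamma>. adds_t_hook t \<gamma> \<alpha> \<and> adds_t_hook t \<gamma> \<beta>"
proof -
  define M where "M = col_length \<alpha> 0 + col_length \<beta> 0 + t"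
  let ?A = "bead_set M \<alpha>" and ?B = "bead_set M \<beta>"
  have Y: "young_diagram \<alpha>" "young_diagram \<beta>"
    using adds_t_hook_young_diagram[OF assms(1)] adds_t_hook_young_diagram[OF assms(2)] by blast+
  have M: "col_length \<alpha> 0 \<le> M" "col_length \<beta> 0 \<le> M" by (simp_all add: M_def)
  obtain a where a: "a \<in> ?A" "a + t \<notin> ?A" "bead_set M \<rho> = move_bead t ?A a"
    using adds_t_hook_bead_set(2)[OF assms(1,4), of M] by (auto simp: M_def)
  obtain b where b: "b \<in> ?B" "b + t \<notin> ?B" "bead_set M \<rho> = move_bead t ?B b"
    using adds_t_hook_bead_set(2)[OF assms(2,4), of M] by (auto simp: M_def)
  have eq: "x = a + t \<or> x \<in> ?A \<and> x \<noteq> a \<longleftrightarrow> x = b + t \<or> x \<in> ?B \<and> x \<noteq> b" for x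
    using a(3) b(3) by (auto simp: move_bead_def)
  have ab: "a \<noteq> b"
  proof
    assume "a = b"
    have "?A = ?B"
    proof (rule set_eqI)
      fix x show "x \<in> ?A \<longleftrightarrow> x \<in> ?B" using eq[of x] a(1,2) b(1,2) \<open>a = b\<close> by metis
    qed
    then show False using bead_set_inject[OF Y M] assms(3) by simp
  qed
  \<comment> \<open>In \<open>\<alpha>\<close> only the move of \<open>a\<close> is undone, so the
    move of \<open>b\<close> can still be undone there, and symmetrically in
    \<open>\<beta>\<close>.\<close>
  have bA: "b + t \<in> ?A" "b \<notin> ?A" and aB: "a + t \<in> ?B" "a \<notin> ?B"
    using eq[of b] eq[of "b + t"] eq[of a] eq[of "a + t"] ab assms(4) by simp_all
  define Z where "Z = insert b (?A - {b + t})"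
  have Z': "Z = insert a (?B - {a + t})"
  proof (rule set_eqI)
    fix x show "x \<in> Z \<longleftrightarrow> x \<in> insert a (?B - {a + t})"
      unfolding Z_def insert_iff Diff_iff singleton_iff
      using eq[of x] a(1,2) b(1,2) aB bA ab
      by (cases "x = a"; cases "x = b"; cases "x = a + t"; cases "x = b + t") simp_all
  qed
  have fin: "finite ?A" "card ?A = M" using finite_bead_set card_bead_set Y M by auto
  then have "finite Z" "card Z = M" using bA card_insert_Diff_singleton[of ?A "b + t" b] by (simp_all add: Z_def)
  then obtain \<gamma> where \<gamma>: "young_diagram \<gamma>" "col_length \<gamma> 0 \<le> M" "bead_set M \<gamma> = Z"
    by (rule bead_set_surj)
  have "adds_t_hook t \<gamma> \<alpha>"
    using bA ab \<gamma> assms(4) by (intro adds_t_hookI[OF \<gamma>(1) Y(1) \<gamma>(2) M(1), of b]) (auto simp: Z_def move_bead_def)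
  moreover have "adds_t_hook t \<gamma> \<beta>"
    using aB ab \<gamma> assms(4) by (intro adds_t_hookI[OF \<gamma>(1) Y(2) \<gamma>(2) M(2), of a]) (auto simp: Z' move_bead_def)
  ultimately show ?thesis by blast
qed

text \<open>The diamond property makes hook removal confluent, so irreducible diagrams below the
  same one coincide. With \<open>terminal_exists\<close> this justifies the \<open>THE\<close> in
  \<open>t_core\<close>.\<close>

lemma terminal_unique:
  assumes "t_geq t \<rho> \<mu>" "t_geq t \<rho> \<mu>'" "\<nexists>\<nu>. adds_t_hook t \<nu> \<mu>" "\<nexists>\<nu>. adds_t_hook t \<nu> \<mu>'" "t > 0"
  shows "\<mu> = \<mu>'"
proof -
  let ?R = "(adds_t_hook t)\<inverse>\<inverse>"
  have "strong_confluentp ?R"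
  proof (rule strong_confluentpI)
    fix x y y' assume "?R x y" "?R x y'"
    then show "\<exists>u. ?R\<^sup>*\<^sup>* y u \<and> ?R\<^sup>=\<^sup>= y' u"
      using adds_t_hook_diamond[of t y x y'] assms(5) by (cases "y = y'") blast+
  qed
  then have "confluentp ?R" by (rule strong_confluentp_imp_confluentp)
  moreover have "?R\<^sup>*\<^sup>* \<rho> \<mu>" "?R\<^sup>*\<^sup>* \<rho> \<mu>'"
    using assms(1,2) by (simp_all add: t_geq_def rtranclp_conversep)
  ultimately obtain u where "?R\<^sup>*\<^sup>* \<mu> u" "?R\<^sup>*\<^sup>* \<mu>' u" by (auto dest: confluentpD)
  then show ?thesis using assms(3,4) by (auto elim: converse_rtranclpE)
qed

lemma terminal_exists:
  assumes "t > 0"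
  shows "\<exists>\<mu>. t_geq t \<rho> \<mu> \<and> (\<nexists>\<nu>. adds_t_hook t \<nu> \<mu>)"
proof (induction "card \<rho>" arbitrary: \<rho> rule: less_induct)
  case less
  show ?case
  proof (cases "\<exists>\<nu>. adds_t_hook t \<nu> \<rho>")
    case True
    then obtain \<nu> where \<nu>: "adds_t_hook t \<nu> \<rho>" by blast
    then have "card \<nu> < card \<rho>" using card_adds_t_hook assms by simp
    from less[OF this] show ?thesis using \<nu> unfolding t_geq_def by (meson rtranclp.rtrancl_into_rtrancl)
  qed (auto simp: t_geq_def)
qed

text \<open>A core in the sense of hook lengths admits no removal, so once it lies below
  \<open>\<rho>\<close> it is the terminal diagram.\<close>

lemma t_core_eq_iff:
  assumes "is_t_core t \<mu>" "t > 0"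
  shows "t_core t \<rho> = \<mu> \<longleftrightarrow> t_geq t \<rho> \<mu>"
proof
  obtain \<mu>' where \<mu>': "t_geq t \<rho> \<mu>' \<and> (\<nexists>\<nu>. adds_t_hook t \<nu> \<mu>')" using terminal_exists[OF assms(2)] by blast
  then have core: "t_core t \<rho> = \<mu>'"
    unfolding t_core_def using terminal_unique[OF _ _ _ _ assms(2)] by (intro the_equality) auto
  show "t_geq t \<rho> \<mu>" if "t_core t \<rho> = \<mu>" using that core \<mu>' by simp
  show "t_core t \<rho> = \<mu>" if "t_geq t \<rho> \<mu>"
    unfolding core
  proof (rule terminal_unique)
    show "t_geq t \<rho> \<mu>'" "\<nexists>\<nu>. adds_t_hook t \<nu> \<mu>'" using \<mu>' by blast+
    show "\<nexists>\<nu>. adds_t_hook t \<nu> \<mu>" using is_t_core_no_removable[OF assms] by blast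
    show "t_geq t \<rho> \<mu>" using that .
    show "t > 0" using assms(2) .
  qed
qed

section \<open>Summation over the levels\<close>

definition level :: "nat \<Rightarrow> (nat \<times> nat) set \<Rightarrow> nat \<Rightarrow> (nat \<times> nat) set set" where
  "level t \<mu> n = {\<rho>. (adds_t_hook t ^^ n) \<mu> \<rho>}"

lemma level_0 [simp]: "level t \<mu> 0 = {\<mu>}"
  by (auto simp: level_def)

lemma level_Suc: "level t \<mu> (Suc n) = (\<Union>\<nu>\<in>level t \<mu> n. {\<rho>. adds_t_hook t \<nu> \<rho>})"
  by (auto simp: level_def)

lemma level_young_diagram:
  assumes "young_diagram \<mu>" "\<rho> \<in> level t \<mu> n"
  shows "young_diagram \<rho>"
  using assms by (cases n) (auto simp: level_Suc dest: adds_t_hook_young_diagram)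

lemma finite_level:
  assumes "young_diagram \<mu>" "t > 0"
  shows "finite (level t \<mu> n)"
  by (induction n) (use assms finite_adds_t_hook level_young_diagram in \<open>auto simp: level_Suc\<close>)

lemma card_level:
  assumes "\<rho> \<in> level t \<mu> n" "t > 0"
  shows "card \<rho> = card \<mu> + n * t"
  using assms(1) by (induction n arbitrary: \<rho>) (auto simp: level_Suc card_adds_t_hook[OF _ assms(2)])

lemma t_geq_iff_level: "t_geq t \<rho> \<mu> \<longleftrightarrow> (\<exists>n. \<rho> \<in> level t \<mu> n)"
  by (simp add: t_geq_def level_def rtranclp_power)

text \<open>Each step adds \<open>t\<close> boxes, so the size determines the number of
  steps.\<close>

lemma level_eq:
  assumes "is_t_core t \<mu>" "t > 0"
  shows "{\<rho>. young_diagram \<rho> \<and> t_core t \<rho> = \<mu> \<and> card \<rho> = card \<mu> + n * t} = level t \<mu> n"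
proof -
  have Y: "young_diagram \<mu>" using assms(1) by (simp add: is_t_core_def)
  show ?thesis
    unfolding t_core_eq_iff[OF assms] t_geq_iff_level
  proof (intro equalityI subsetI)
    fix \<rho> assume "\<rho> \<in> {\<rho>. young_diagram \<rho> \<and> (\<exists>m. \<rho> \<in> level t \<mu> m) \<and> card \<rho> = card \<mu> + n * t}"
    then obtain m where m: "\<rho> \<in> level t \<mu> m" "card \<rho> = card \<mu> + n * t" by blast
    then have "m = n" using card_level[OF m(1) assms(2)] assms(2) by simp
    then show "\<rho> \<in> level t \<mu> n" using m by simp
  next
    fix \<rho> assume "\<rho> \<in> level t \<mu> n"
    then show "\<rho> \<in> {\<rho>. young_diagram \<rho> \<and> (\<exists>m. \<rho> \<in> level t \<mu> m) \<and> card \<rho> = card \<mu> + n * t}"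
      using level_young_diagram[OF Y] card_level[OF _ assms(2)] by blast
  qed
qed

text \<open>The recursion of \<open>F_skew\<close> selects by size; along a chain of hooks, a
  difference of \<open>t\<close> boxes means exactly one hook.\<close>

lemma F_skew_level_Suc:
  assumes "\<rho> \<in> level t \<mu> (Suc n)" "t > 0"
  shows "F_skew t \<rho> \<mu> = (\<Sum>\<nu> | \<nu> \<in> level t \<mu> n \<and> adds_t_hook t \<nu> \<rho>. F_skew t \<nu> \<mu>)"
proof -
  note c = card_level[OF _ assms(2)]
  have "{\<nu>. t_geq t \<rho> \<nu> \<and> t_geq t \<nu> \<mu> \<and> card \<rho> = card \<nu> + t}
    = {\<nu>. \<nu> \<in> level t \<mu> n \<and> adds_t_hook t \<nu> \<rho>}"
  proof (intro equalityI subsetI CollectI; elim CollectE conjE)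
    fix \<nu> assume \<nu>: "t_geq t \<rho> \<nu>" "t_geq t \<nu> \<mu>" "card \<rho> = card \<nu> + t"
    obtain i j where ij: "\<rho> \<in> level t \<nu> i" "\<nu> \<in> level t \<mu> j" using \<nu>(1,2) by (auto simp: t_geq_iff_level)
    have "i = 1" using c[OF ij(1)] \<nu>(3) assms(2) by simp
    moreover have "j = n" using c[OF ij(2)] c[OF assms(1)] \<nu>(3) assms(2) by simp
    ultimately show "\<nu> \<in> level t \<mu> n \<and> adds_t_hook t \<nu> \<rho>" using ij by (simp add: level_Suc)
  next
    fix \<nu> assume \<nu>: "\<nu> \<in> level t \<mu> n" "adds_t_hook t \<nu> \<rho>"
    have "t_geq t \<rho> \<nu>" using \<nu>(2) by (simp add: t_geq_def)
    moreover have "t_geq t \<nu> \<mu>" using \<nu>(1) t_geq_iff_level by blast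
    ultimately show "t_geq t \<rho> \<nu> \<and> t_geq t \<nu> \<mu> \<and> card \<rho> = card \<nu> + t"
      using card_adds_t_hook[OF \<nu>(2) assms(2)] by blast
  qed
  moreover have "\<rho> \<noteq> \<mu>" using c[OF assms(1)] assms(2) by auto
  ultimately show ?thesis by (subst F_skew.simps) simp
qed

text \<open>Exchanging the sums turns the downward recursion of \<open>F_skew\<close> into an upward
  step from each \<open>\<nu>\<close>, which is the transition of a Markov chain.\<close>

lemma sum_level_Suc:
  fixes h :: "(nat \<times> nat) set \<Rightarrow> real"
  assumes "young_diagram \<mu>" "t > 0"
  shows "(\<Sum>\<rho>\<in>level t \<mu> (Suc n). F_skew t \<rho> \<mu> * h \<rho>)
    = (\<Sum>\<nu>\<in>level t \<mu> n. F_skew t \<nu> \<mu> * (\<Sum>\<rho> | adds_t_hook t \<nu> \<rho>. h \<rho>))"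
proof -
  have "(\<Sum>\<rho>\<in>level t \<mu> (Suc n). F_skew t \<rho> \<mu> * h \<rho>)
    = (\<Sum>\<rho>\<in>level t \<mu> (Suc n). \<Sum>\<nu> | \<nu> \<in> level t \<mu> n \<and> adds_t_hook t \<nu> \<rho>. F_skew t \<nu> \<mu> * h \<rho>)"
    by (simp add: F_skew_level_Suc[OF _ assms(2)] sum_distrib_right)
  also have "\<dots> = (\<Sum>\<nu>\<in>level t \<mu> n. \<Sum>\<rho> | \<rho> \<in> level t \<mu> (Suc n) \<and> adds_t_hook t \<nu> \<rho>. F_skew t \<nu> \<mu> * h \<rho>)"
    by (rule sum.swap_restrict) (simp_all add: finite_level assms)
  also have "\<dots> = (\<Sum>\<nu>\<in>level t \<mu> n. \<Sum>\<rho> | adds_t_hook t \<nu> \<rho>. F_skew t \<nu> \<mu> * h \<rho>)"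
    by (intro sum.cong refl) (auto simp: level_Suc)
  finally show ?thesis by (simp only: sum_distrib_left)
qed

text \<open>\<open>F_skew * G_fun\<close> is the distribution after \<open>n\<close> transitions
  from the core: the total starts at \<open>G_fun t \<mu> = 1\<close> and each transition preserves
  it.\<close>

lemma sum_level_G_fun:
  assumes "is_t_core t \<mu>" "t > 0"
  shows "(\<Sum>\<rho>\<in>level t \<mu> n. F_skew t \<rho> \<mu> * G_fun t \<rho>) = 1"
proof -
  have Y: "young_diagram \<mu>" using assms(1) by (simp add: is_t_core_def)
  show ?thesis
  proof (induction n)
    case 0
    then show ?case by (simp add: G_fun_core[OF assms(1)] F_skew.simps[of t \<mu> \<mu>])
  next
    case (Suc n)
    have "(\<Sum>\<rho>\<in>level t \<mu> (Suc n). F_skew t \<rho> \<mu> * G_fun t \<rho>)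
      = (\<Sum>\<nu>\<in>level t \<mu> n. F_skew t \<nu> \<mu> * G_fun t \<nu>)"
      unfolding sum_level_Suc[OF Y assms(2)]
      using level_young_diagram[OF Y] sum_G_fun_adds_t_hook[OF _ assms(2)] by (intro sum.cong) auto
    then show ?case using Suc by simp
  qed
qed

text \<open>Every hook raises the mean gain by the same amount, so it is constant on a level; this
  closes the recursion for the expectation.\<close>

lemma mean_gain_level:
  assumes "\<rho> \<in> level t \<mu> n" "0 < k" "k < t"
  shows "mean_gain t k \<rho> = mean_gain t k \<mu> + 6 * real t * real n"
  using assms(1)
  by (induction n arbitrary: \<rho>)
    (auto simp: level_Suc mean_gain_adds_t_hook[OF _ assms(2,3)] distrib_left)

text \<open>From level \<open>n\<close> to \<open>n + 1\<close> the expectation rises by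
  \<open>mean_gain t k \<mu> + 6 * t * n\<close>, and the numbers below \<open>n\<close> add up to
  \<open>n choose 2\<close>.\<close>

lemma sum_level_hook_squares:
  assumes "is_t_core t \<mu>" "0 < k" "k < t"
  shows "(\<Sum>\<rho>\<in>level t \<mu> n. F_skew t \<rho> \<mu> * G_fun t \<rho> * hook_squares t k \<rho>)
    = 6 * real t * real (n choose 2) + mean_gain t k \<mu> * n + hook_squares t k \<mu>"
proof -
  have Y: "young_diagram \<mu>" and t: "t > 0" using assms by (auto simp: is_t_core_def)
  show ?thesis
  proof (induction n)
    case 0
    then show ?case by (simp add: G_fun_core[OF assms(1)] F_skew.simps[of t \<mu> \<mu>])
  next
    case (Suc n)
    have "(\<Sum>\<rho>\<in>level t \<mu> (Suc n). F_skew t \<rho> \<mu> * G_fun t \<rho> * hook_squares t k \<rho>)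
      = (\<Sum>\<nu>\<in>level t \<mu> n. F_skew t \<nu> \<mu> * (\<Sum>\<rho> | adds_t_hook t \<nu> \<rho>. G_fun t \<rho> * hook_squares t k \<rho>))"
      unfolding mult.assoc by (rule sum_level_Suc[OF Y t])
    also have "\<dots> = (\<Sum>\<nu>\<in>level t \<mu> n. F_skew t \<nu> \<mu> * G_fun t \<nu> * hook_squares t k \<nu>
        + (mean_gain t k \<mu> + 6 * real t * real n) * (F_skew t \<nu> \<mu> * G_fun t \<nu>))"
    proof (rule sum.cong)
      fix \<nu> assume \<nu>: "\<nu> \<in> level t \<mu> n"
      show "F_skew t \<nu> \<mu> * (\<Sum>\<rho> | adds_t_hook t \<nu> \<rho>. G_fun t \<rho> * hook_squares t k \<rho>)
        = F_skew t \<nu> \<mu> * G_fun t \<nu> * hook_squares t k \<nu>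
          + (mean_gain t k \<mu> + 6 * real t * real n) * (F_skew t \<nu> \<mu> * G_fun t \<nu>)"
        unfolding sum_G_fun_hook_squares_adds_t_hook[OF level_young_diagram[OF Y \<nu>] t]
          mean_gain_level[OF \<nu> assms(2,3)]
        by (simp add: algebra_simps)
    qed simp
    also have "\<dots> = 6 * real t * real (Suc n choose 2) + mean_gain t k \<mu> * Suc n + hook_squares t k \<mu>"
      unfolding sum.distrib sum_distrib_left[symmetric] sum_level_G_fun[OF assms(1) t] Suc
      by (simp add: numeral_2_eq_2 algebra_simps)
    finally show ?case .
  qed
qed

theorem theorem1p6:
  fixes t k :: nat
  assumes "t > 0" and "1 \<le> k" and "k \<le> t - 1"
  shows
    "(\<forall>\<mu> n. is_t_core t \<mu> \<longrightarrow>
        (\<Sum>\<rho> | young_diagram \<rho> \<and> t_core t \<rho> = \<mu> \<and> card \<rho> = card \<mu> + n * t.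
           real (F_skew t \<rho> \<mu>) * G_fun t \<rho> *
           ((\<Sum>b | b \<in> \<rho> \<and> [hook_length \<rho> b = k] (mod t). (real (hook_length \<rho> b))\<^sup>2) +
            (\<Sum>b | b \<in> \<rho> \<and> [hook_length \<rho> b = t - k] (mod t). (real (hook_length \<rho> b))\<^sup>2)))
        = 6 * real t * real (n choose 2)
          + (2 * real k * (real t - real k)
             + 4 * real t * real (size (hook_lengths_mod t \<mu> k))
             + 4 * real t * real (size (hook_lengths_mod t \<mu> (t - k)))) * real n
          + (\<Sum>b | b \<in> \<mu> \<and> [hook_length \<mu> b = k] (mod t). (real (hook_length \<mu> b))\<^sup>2)
          + (\<Sum>b | b \<in> \<mu> \<and> [hook_length \<mu> b = t - k] (mod t). (real (hook_length \<mu> b))\<^sup>2))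
     \<and>
     (\<forall>n.
        (\<Sum>\<rho> | young_diagram \<rho> \<and> t_core t \<rho> = {} \<and> card \<rho> = n * t.
           real (F_fun t \<rho>) * G_fun t \<rho> *
           ((\<Sum>b | b \<in> \<rho> \<and> [hook_length \<rho> b = k] (mod t). (real (hook_length \<rho> b))\<^sup>2) +
            (\<Sum>b | b \<in> \<rho> \<and> [hook_length \<rho> b = t - k] (mod t). (real (hook_length \<rho> b))\<^sup>2)))
        = 6 * real t * real (n choose 2) + 2 * real k * (real t - real k) * real n)"
proof (intro conjI allI impI)
  have k: "0 < k" "k < t" using assms by auto
  show main': "(\<Sum>\<rho> | young_diagram \<rho> \<and> t_core t \<rho> = \<mu> \<and> card \<rho> = card \<mu> + n * t.
      real (F_skew t \<rho> \<mu>) * G_fun t \<rho> *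
      ((\<Sum>b | b \<in> \<rho> \<and> [hook_length \<rho> b = k] (mod t). (real (hook_length \<rho> b))\<^sup>2) +
       (\<Sum>b | b \<in> \<rho> \<and> [hook_length \<rho> b = t - k] (mod t). (real (hook_length \<rho> b))\<^sup>2)))
    = 6 * real t * real (n choose 2)
      + (2 * real k * (real t - real k)
         + 4 * real t * real (size (hook_lengths_mod t \<mu> k))
         + 4 * real t * real (size (hook_lengths_mod t \<mu> (t - k)))) * real n
      + (\<Sum>b | b \<in> \<mu> \<and> [hook_length \<mu> b = k] (mod t). (real (hook_length \<mu> b))\<^sup>2)
      + (\<Sum>b | b \<in> \<mu> \<and> [hook_length \<mu> b = t - k] (mod t). (real (hook_length \<mu> b))\<^sup>2)"
    if "is_t_core t \<mu>" for \<mu> n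
    using sum_level_hook_squares[OF that k, of n]
    unfolding level_eq[OF that assms(1), symmetric] hook_squares_def mean_gain_core[OF that k]
    by (simp only: add.assoc)
  fix n
  have core: "is_t_core t {}" by (simp add: is_t_core_def young_diagram_def hook_lengths_def)
  have "(\<Sum>\<rho> | young_diagram \<rho> \<and> t_core t \<rho> = {} \<and> card \<rho> = n * t.
      real (F_fun t \<rho>) * G_fun t \<rho> *
      ((\<Sum>b | b \<in> \<rho> \<and> [hook_length \<rho> b = k] (mod t). (real (hook_length \<rho> b))\<^sup>2) +
       (\<Sum>b | b \<in> \<rho> \<and> [hook_length \<rho> b = t - k] (mod t). (real (hook_length \<rho> b))\<^sup>2)))
    = (\<Sum>\<rho> | young_diagram \<rho> \<and> t_core t \<rho> = {} \<and> card \<rho> = card ({} :: (nat \<times> nat) set) + n * t.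
      real (F_skew t \<rho> {}) * G_fun t \<rho> *
      ((\<Sum>b | b \<in> \<rho> \<and> [hook_length \<rho> b = k] (mod t). (real (hook_length \<rho> b))\<^sup>2) +
       (\<Sum>b | b \<in> \<rho> \<and> [hook_length \<rho> b = t - k] (mod t). (real (hook_length \<rho> b))\<^sup>2)))"
    \<comment> \<open>Within the range of summation the core is \<open>{}\<close>, so
      \<open>F_fun\<close> is \<open>F_skew\<close> over \<open>{}\<close>.\<close>
    by (rule sum.cong) (auto simp: F_fun_def)
  also have "\<dots> = 6 * real t * real (n choose 2) + 2 * real k * (real t - real k) * real n"
    unfolding main'[OF core] by (simp add: hook_lengths_mod_def hook_lengths_def)
  finally show "(\<Sum>\<rho> | young_diagram \<rho> \<and> t_core t \<rho> = {} \<and> card \<rho> = n * t.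
      real (F_fun t \<rho>) * G_fun t \<rho> *
      ((\<Sum>b | b \<in> \<rho> \<and> [hook_length \<rho> b = k] (mod t). (real (hook_length \<rho> b))\<^sup>2) +
       (\<Sum>b | b \<in> \<rho> \<and> [hook_length \<rho> b = t - k] (mod t). (real (hook_length \<rho> b))\<^sup>2)))
    = 6 * real t * real (n choose 2) + 2 * real k * (real t - real k) * real n" .
qed

end
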